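(* Let $Q$ be a finite quiver with a stability function $Z$. Then $a_Z(Q)\in\mathbb N[q]$.
   Context: $\mathbb N=\{0,1,2,\dots\}$. $Q$ is a finite quiver with vertex set $Q_0$ and arrow set $Q_1$. A stability function is a group homomorphism $Z:\mathbb Z^{Q_0}\to\mathbb C$ with $Z(i)\in\{re^{i\pi\varphi}:r>0,\,0<\varphi\le1\}$ for all $i\in Q_0$ (where $i$ also denotes the corresponding basis vector). Writing $Z=-d+\sqrt{-1}\,r$ with $d,r$ real-valued, the slope is $\mu_Z(\alpha)=d(\alpha)/r(\alpha)\in\mathbb R\cup\{\infty\}$ for nonzero $\alpha\in\mathbb N^{Q_0}$; for non-empty $I\subset Q_0$ put $\mu_Z(I)=\mu_Z(\sum_{i\in I}i)$. An abelian representation of $Q$ is a representation with dimension one at every vertex; these form the affine space $R(Q)=\mathbb A^{Q_1}$, acted on by $G(Q)=\mathbb G_m^{Q_0}$. It is $Z$-semistable if every proper nonzero subrepresentation has slope at most that of the representation. Let $R_Z^{\mathrm{ind}}(Q)\subset R(Q)$ be the locus of indecomposable $Z$-semistable abelian representations, and let $[\cdot]$ be the class in the Grothendieck ring of complex varieties, with $q=[\mathbb A^1]$. Define $$a_Z(Q)=(q-1)\frac{[R_Z^{\mathrm{ind}}(Q)]}{[G(Q)]}.$$ Equivalently, $a_Z(Q)=\sum_{G\in\mathcal C_Z(Q)}(q-1)^{n(G)}\in\mathbb Z[q]$, where $n(G)=|G_1|-|G_0|+1$ and $\mathcal C_Z(Q)$ is the set of subquivers $G\subset Q$ with $G_0=Q_0$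 which are connected (as undirected graphs) and $Z$-semistable, meaning that $\mu_Z(I)\le\mu_Z(Q_0)$ for every non-empty proper subset $I\subset Q_0$ such that $G$ has no arrows from $I$ to $Q_0\setminus I$. (Over a finite field, $a_Z(Q)(q)$ is the number of isomorphism classes of indecomposable $Z$-semistable abelian representations of $Q$ over $\mathbb F_q$.) *)

theory Defs
  imports
    "HOL-Analysis.Analysis"
    "HOL-Library.Poly_Mapping"
    "HOL-Computational_Algebra.Polynomial"
    "Graph_Theory.Digraph_Component"
begin

section \<open>The Grothendieck ring of complex varieties\<close>

text \<open>
  As additive generators we use the quasi-affine varieties, i.e. the locally closed subsets of the
  affine spaces, up to regular isomorphism. Every complex variety is a finite disjoint union of
  locally closed quasi-affine ones, and quasi-affine varieties are stable under products and under
  passing to locally closed subsets. Hence the ring defined here is the usual ring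
  $K_0(\mathrm{Var}_{\mathbb C})$. The points of affine $n$-space are the lists of length $n$, so
  that the product of varieties is given by concatenation of lists.
\<close>

definition affine_space :: "nat \<Rightarrow> complex list set" where
  "affine_space n = {xs. length xs = n}"

inductive_set poly_fun :: "nat \<Rightarrow> (complex list \<Rightarrow> complex) set" for n where
  const: "(\<lambda>_. c) \<in> poly_fun n"
| coord: "i < n \<Longrightarrow> (\<lambda>xs. xs ! i) \<in> poly_fun n"
| add: "f \<in> poly_fun n \<Longrightarrow> g \<in> poly_fun n \<Longrightarrow> (\<lambda>xs. f xs + g xs) \<in> poly_fun n"
| mult: "f \<in> poly_fun n \<Longrightarrow> g \<in> poly_fun n \<Longrightarrow> (\<lambda>xs. f xs * g xs) \<in> poly_fun n"

definition zariski_closed :: "nat \<Rightarrow> complex list set \<Rightarrow> bool" where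
  "zariski_closed n C \<longleftrightarrow>
     (\<exists>F \<subseteq> poly_fun n. C = {xs \<in> affine_space n. \<forall>f\<in>F. f xs = 0})"

definition quasi_affine :: "complex list set \<Rightarrow> bool" where
  "quasi_affine X \<longleftrightarrow>
     (\<exists>n C D. zariski_closed n C \<and> zariski_closed n D \<and> X = C - D)"

definition closed_subvariety :: "complex list set \<Rightarrow> complex list set \<Rightarrow> bool" where
  "closed_subvariety Y X \<longleftrightarrow> (\<exists>n C. X \<subseteq> affine_space n \<and> zariski_closed n C \<and> Y = X \<inter> C)"

text \<open>
  The sets where some polynomial function does not vanish form a basis of the Zariski topology,
  so it suffices to consider these as neighbourhoods of a point.
\<close>

definition regular_function :: "nat \<Rightarrow> complex list set \<Rightarrow> (complex list \<Rightarrow> complex) \<Rightarrow> bool" where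
  "regular_function n X f \<longleftrightarrow>
     (\<forall>x\<in>X. \<exists>p\<in>poly_fun n. \<exists>q\<in>poly_fun n.
        q x \<noteq> 0 \<and> (\<forall>y\<in>X. q y \<noteq> 0 \<longrightarrow> f y = p y / q y))"

definition regular_map ::
    "complex list set \<Rightarrow> complex list set \<Rightarrow> (complex list \<Rightarrow> complex list) \<Rightarrow> bool" where
  "regular_map X Y f \<longleftrightarrow>
     (\<exists>n m. X \<subseteq> affine_space n \<and> Y \<subseteq> affine_space m \<and> f ` X \<subseteq> Y \<and>
        (\<forall>j<m. regular_function n X (\<lambda>x. f x ! j)))"

definition isomorphic_varieties :: "complex list set \<Rightarrow> complex list set \<Rightarrow> bool" where
  "isomorphic_varieties X Y \<longleftrightarrow>
     (\<exists>f g. regular_map X Y f \<and> regular_map Y X g \<and>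
        (\<forall>x\<in>X. g (f x) = x) \<and> (\<forall>y\<in>Y. f (g y) = y))"

definition product_variety :: "complex list set \<Rightarrow> complex list set \<Rightarrow> complex list set" where
  "product_variety X Y = {xs @ ys | xs ys. xs \<in> X \<and> ys \<in> Y}"

subsection \<open>Quasi-affine varieties are closed under products\<close>

lemma poly_fun_prod:
  assumes "finite I" "\<And>i. i \<in> I \<Longrightarrow> f i \<in> poly_fun n"
  shows "(\<lambda>xs. \<Prod>i\<in>I. f i xs) \<in> poly_fun n"
  using assms by (induction I rule: finite_induct) (auto intro: poly_fun.intros)

lemma poly_fun_take:
  assumes "f \<in> poly_fun n"
  shows "(\<lambda>xs. f (take n xs)) \<in> poly_fun (n + m)"
  using assms by induction (auto intro: poly_fun.intros)

lemma poly_fun_drop: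
  assumes "f \<in> poly_fun m"
  shows "\<exists>g\<in>poly_fun (n + m). \<forall>xs\<in>affine_space (n + m). g xs = f (drop n xs)"
  using assms
proof induction
  case (const c)
  then show ?case by (auto intro: poly_fun.const)
next
  case (coord i)
  then show ?case
    by (intro bexI[of _ "\<lambda>xs. xs ! (n + i)"] poly_fun.coord) (auto simp: affine_space_def)
next
  case (add f g)
  then obtain f' g' where "f' \<in> poly_fun (n + m)" "g' \<in> poly_fun (n + m)"
      "\<forall>xs\<in>affine_space (n + m). f' xs = f (drop n xs)"
      "\<forall>xs\<in>affine_space (n + m). g' xs = g (drop n xs)"
    by blast
  then show ?case by (intro bexI[of _ "\<lambda>xs. f' xs + g' xs"] poly_fun.add) auto
next
  case (mult f g)
  then obtain f' g' where "f' \<in> poly_fun (n + m)" "g' \<in> poly_fun (n + m)"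
      "\<forall>xs\<in>affine_space (n + m). f' xs = f (drop n xs)"
      "\<forall>xs\<in>affine_space (n + m). g' xs = g (drop n xs)"
    by blast
  then show ?case by (intro bexI[of _ "\<lambda>xs. f' xs * g' xs"] poly_fun.mult) auto
qed

lemma zariski_closed_affine_space: "zariski_closed n (affine_space n)"
  unfolding zariski_closed_def by (intro exI[of _ "{}"]) auto

lemma zariski_closed_subset: "zariski_closed n C \<Longrightarrow> C \<subseteq> affine_space n"
  unfolding zariski_closed_def by auto

lemma quasi_affine_subset: "quasi_affine X \<Longrightarrow> \<exists>n. X \<subseteq> affine_space n"
  unfolding quasi_affine_def using zariski_closed_subset by blast

lemma zariski_closed_Int:
  assumes "zariski_closed n C" "zariski_closed n D"
  shows "zariski_closed n (C \<inter> D)"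
proof -
  obtain F G where "F \<subseteq> poly_fun n" "C = {xs \<in> affine_space n. \<forall>f\<in>F. f xs = 0}"
      "G \<subseteq> poly_fun n" "D = {xs \<in> affine_space n. \<forall>f\<in>G. f xs = 0}"
    using assms unfolding zariski_closed_def by blast
  then show ?thesis unfolding zariski_closed_def by (intro exI[of _ "F \<union> G"]) auto
qed

lemma zariski_closed_Un:
  assumes "zariski_closed n C" "zariski_closed n D"
  shows "zariski_closed n (C \<union> D)"
proof -
  obtain F G where FG: "F \<subseteq> poly_fun n" "C = {xs \<in> affine_space n. \<forall>f\<in>F. f xs = 0}"
      "G \<subseteq> poly_fun n" "D = {xs \<in> affine_space n. \<forall>f\<in>G. f xs = 0}"
    using assms unfolding zariski_closed_def by blast
  have "C \<union> D =
      {xs \<in> affine_space n. \<forall>h\<in>(\<lambda>(f, g) xs. f xs * g xs) ` (F \<times> G). h xs = 0}"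
    unfolding FG by auto
  moreover have "(\<lambda>(f, g) xs. f xs * g xs) ` (F \<times> G) \<subseteq> poly_fun n"
    using FG by (auto intro!: poly_fun.mult)
  ultimately show ?thesis unfolding zariski_closed_def by blast
qed

lemma zariski_closed_take:
  assumes "zariski_closed n C"
  shows "zariski_closed (n + m) {xs \<in> affine_space (n + m). take n xs \<in> C}"
proof -
  obtain F where F: "F \<subseteq> poly_fun n" "C = {xs \<in> affine_space n. \<forall>f\<in>F. f xs = 0}"
    using assms unfolding zariski_closed_def by blast
  have "(\<lambda>f xs. f (take n xs)) ` F \<subseteq> poly_fun (n + m)"
    using F poly_fun_take by blast
  then show ?thesis unfolding zariski_closed_def F
    by (intro exI[of _ "(\<lambda>f xs. f (take n xs)) ` F"]) (auto simp: affine_space_def)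
qed

lemma zariski_closed_drop:
  assumes "zariski_closed m C"
  shows "zariski_closed (n + m) {xs \<in> affine_space (n + m). drop n xs \<in> C}"
proof -
  obtain F where F: "F \<subseteq> poly_fun m" "C = {xs \<in> affine_space m. \<forall>f\<in>F. f xs = 0}"
    using assms unfolding zariski_closed_def by blast
  then have "\<forall>f\<in>F. \<exists>g. g \<in> poly_fun (n + m) \<and>
      (\<forall>xs\<in>affine_space (n + m). g xs = f (drop n xs))"
    using poly_fun_drop by blast
  then obtain h where h: "\<And>f. f \<in> F \<Longrightarrow> h f \<in> poly_fun (n + m)"
      "\<And>f xs. f \<in> F \<Longrightarrow> xs \<in> affine_space (n + m) \<Longrightarrow> h f xs = f (drop n xs)"
    by metis
  show ?thesis unfolding zariski_closed_def
  proof (intro exI[of _ "h ` F"] conjI)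
    show "h ` F \<subseteq> poly_fun (n + m)" using h by blast
    have "drop n xs \<in> affine_space m" if "xs \<in> affine_space (n + m)" for xs
      using that by (simp add: affine_space_def)
    then show "{xs \<in> affine_space (n + m). drop n xs \<in> C} =
        {xs \<in> affine_space (n + m). \<forall>f\<in>h ` F. f xs = 0}"
      using h F by auto
  qed
qed

lemma in_product_variety:
  "zs \<in> product_variety X Y \<longleftrightarrow> (\<exists>xs\<in>X. \<exists>ys\<in>Y. zs = xs @ ys)"
  unfolding product_variety_def by blast

lemma product_variety_assoc:
  "product_variety (product_variety X Y) W = product_variety X (product_variety Y W)"
  by (simp add: set_eq_iff in_product_variety Bex_def) (metis append.assoc)

lemma product_variety_eq:
  assumes "X \<subseteq> affine_space n" "Y \<subseteq> affine_space m"
  shows "product_variety X Y = {xs \<in> affine_space (n + m). take n xs \<in> X \<and> drop n xs \<in> Y}"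
proof (intro equalityI subsetI)
  fix zs assume "zs \<in> product_variety X Y"
  then obtain xs ys where "zs = xs @ ys" "xs \<in> X" "ys \<in> Y"
    unfolding product_variety_def by blast
  then show "zs \<in> {xs \<in> affine_space (n + m). take n xs \<in> X \<and> drop n xs \<in> Y}"
    using assms by (auto simp: affine_space_def)
next
  fix zs assume "zs \<in> {xs \<in> affine_space (n + m). take n xs \<in> X \<and> drop n xs \<in> Y}"
  then show "zs \<in> product_variety X Y"
    unfolding product_variety_def by (metis (mono_tags, lifting) append_take_drop_id mem_Collect_eq)
qed

lemma quasi_affine_product_variety:
  assumes "quasi_affine X" "quasi_affine Y"
  shows "quasi_affine (product_variety X Y)"
proof -
  obtain n C D where X: "zariski_closed n C" "zariski_closed n D" "X = C - D"
    using assms(1) unfolding quasi_affine_def by blast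
  obtain m C' D' where Y: "zariski_closed m C'" "zariski_closed m D'" "Y = C' - D'"
    using assms(2) unfolding quasi_affine_def by blast
  let ?P = "\<lambda>C. {xs \<in> affine_space (n + m). take n xs \<in> C}"
  let ?Q = "\<lambda>C. {xs \<in> affine_space (n + m). drop n xs \<in> C}"
  have "product_variety X Y = (?P C \<inter> ?Q C') - (?P D \<union> ?Q D')"
    using X Y zariski_closed_subset by (subst product_variety_eq[of X n Y m]) blast+
  moreover have "zariski_closed (n + m) (?P C \<inter> ?Q C')" "zariski_closed (n + m) (?P D \<union> ?Q D')"
    using X Y by (simp_all add: zariski_closed_Int zariski_closed_Un zariski_closed_take
        zariski_closed_drop del: Int_Collect)
  ultimately show ?thesis unfolding quasi_affine_def by blast
qed

lemma quasi_affine_point: "quasi_affine {[]}"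
proof -
  have "zariski_closed 0 {}"
    unfolding zariski_closed_def by (intro exI[of _ "{\<lambda>_. 1}"]) (auto intro: poly_fun.const)
  moreover have "zariski_closed 0 {[]}"
    using zariski_closed_affine_space[of 0] by (simp add: affine_space_def)
  ultimately show ?thesis unfolding quasi_affine_def by blast
qed

typedef variety = "{X. quasi_affine X}"
  morphisms points Variety
  using quasi_affine_point by blast

setup_lifting type_definition_variety

text \<open>
  The sum on this type is the product of varieties (not their union): it makes the finitely
  supported functions \<open>variety \<Rightarrow>\<^sub>0 int\<close> with their convolution product the ring of formal integer
  combinations of varieties.
\<close>

instantiation variety :: monoid_add
begin

lift_definition zero_variety :: variety is "{[]}"
  by (rule quasi_affine_point)

lift_definition plus_variety :: "variety \<Rightarrow> variety \<Rightarrow> variety" is product_variety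
  by (rule quasi_affine_product_variety)

instance
proof
  fix a b c :: variety
  show "a + b + c = a + (b + c)"
    by transfer (rule product_variety_assoc)
  show "0 + a = a" by transfer (simp add: product_variety_def)
  show "a + 0 = a" by transfer (simp add: product_variety_def)
qed

end

text \<open>
  The scissor relations are stable under products, so the ideal which they generate together with
  the isomorphism relations coincides with the subgroup which they generate.
\<close>

inductive_set scissor_ideal :: "(variety \<Rightarrow>\<^sub>0 int) set" where
  iso: "isomorphic_varieties (points X) (points Y) \<Longrightarrow>
    Poly_Mapping.single X 1 - Poly_Mapping.single Y 1 \<in> scissor_ideal"
| scissor: "closed_subvariety (points Y) (points X) \<Longrightarrow> points U = points X - points Y \<Longrightarrow>
    Poly_Mapping.single X 1 - (Poly_Mapping.single Y 1 + Poly_Mapping.single U 1) \<in> scissor_ideal"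
| zero: "0 \<in> scissor_ideal"
| diff: "a \<in> scissor_ideal \<Longrightarrow> b \<in> scissor_ideal \<Longrightarrow> a - b \<in> scissor_ideal"
| mult_left: "a \<in> scissor_ideal \<Longrightarrow> c * a \<in> scissor_ideal"
| mult_right: "a \<in> scissor_ideal \<Longrightarrow> a * c \<in> scissor_ideal"

lemma scissor_ideal_uminus: "a \<in> scissor_ideal \<Longrightarrow> - a \<in> scissor_ideal"
  using scissor_ideal.diff[OF scissor_ideal.zero] by fastforce

lemma scissor_ideal_add: "a \<in> scissor_ideal \<Longrightarrow> b \<in> scissor_ideal \<Longrightarrow> a + b \<in> scissor_ideal"
  using scissor_ideal.diff[OF _ scissor_ideal_uminus] by fastforce

lemma regular_map_swap:
  assumes "X \<subseteq> affine_space n" "Y \<subseteq> affine_space m"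
  shows "regular_map (product_variety X Y) (product_variety Y X) (\<lambda>xs. drop n xs @ take n xs)"
proof -
  have reg: "regular_function (n + m) (product_variety X Y) (\<lambda>xs. (drop n xs @ take n xs) ! j)"
    if "j < m + n" for j
  proof -
    define k where "k = (if j < m then n + j else j - m)"
    have "k < n + m" using that by (auto simp: k_def)
    moreover have "(drop n xs @ take n xs) ! j = xs ! k" if "xs \<in> product_variety X Y" for xs
      using that \<open>j < m + n\<close> assms
      by (auto simp: product_variety_eq[OF assms] affine_space_def k_def nth_append)
    ultimately have "(\<lambda>xs. xs ! k) \<in> poly_fun (n + m)" "(\<lambda>_. 1) \<in> poly_fun (n + m)"
      "\<forall>y\<in>product_variety X Y. (\<lambda>_. 1 :: complex) y \<noteq> 0 \<longrightarrow>
        (drop n y @ take n y) ! j = (\<lambda>xs. xs ! k) y / (\<lambda>_. 1) y"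
      by (auto intro: poly_fun.intros)
    then show ?thesis unfolding regular_function_def by (metis zero_neq_one)
  qed
  have "product_variety X Y \<subseteq> affine_space (n + m)" "product_variety Y X \<subseteq> affine_space (m + n)"
    using assms by (auto simp: product_variety_eq)
  moreover have "(\<lambda>xs. drop n xs @ take n xs) ` product_variety X Y \<subseteq> product_variety Y X"
    by (auto simp: product_variety_eq[OF assms]) (auto simp: product_variety_def)
  ultimately have "product_variety X Y \<subseteq> affine_space (n + m) \<and>
      product_variety Y X \<subseteq> affine_space (m + n) \<and>
      (\<lambda>xs. drop n xs @ take n xs) ` product_variety X Y \<subseteq> product_variety Y X \<and>
      (\<forall>j<m + n. regular_function (n + m) (product_variety X Y)
        (\<lambda>xs. (drop n xs @ take n xs) ! j))"
    using reg by simp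
  then show ?thesis unfolding regular_map_def by (intro exI)
qed

lemma isomorphic_product_swap:
  assumes "quasi_affine X" "quasi_affine Y"
  shows "isomorphic_varieties (product_variety X Y) (product_variety Y X)"
proof -
  obtain n where n: "X \<subseteq> affine_space n" using quasi_affine_subset[OF assms(1)] ..
  obtain m where m: "Y \<subseteq> affine_space m" using quasi_affine_subset[OF assms(2)] ..
  note nm = n m
  define f g :: "complex list \<Rightarrow> complex list"
    where "f = (\<lambda>xs. drop n xs @ take n xs)" and "g = (\<lambda>xs. drop m xs @ take m xs)"
  have "regular_map (product_variety X Y) (product_variety Y X) f"
    "regular_map (product_variety Y X) (product_variety X Y) g"
    unfolding f_def g_def using nm by (simp_all add: regular_map_swap)
  moreover have "\<forall>xs\<in>product_variety X Y. g (f xs) = xs"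
    by (auto simp: product_variety_eq[OF nm] affine_space_def f_def g_def)
  moreover have "\<forall>xs\<in>product_variety Y X. f (g xs) = xs"
    by (auto simp: product_variety_eq[OF nm(2,1)] affine_space_def f_def g_def)
  ultimately show ?thesis unfolding isomorphic_varieties_def by blast
qed

lemma scissor_ideal_commutator: "a * b - b * a \<in> scissor_ideal"
proof -
  have single: "frag_of X * frag_of Y - frag_of Y * frag_of X \<in> scissor_ideal" for X Y :: variety
  proof -
    have "frag_of (X + Y) - frag_of (Y + X) \<in> scissor_ideal"
      by (rule scissor_ideal.iso) (transfer, simp add: isomorphic_product_swap)
    then show ?thesis by (simp add: mult_single)
  qed
  have left: "a * frag_of Y - frag_of Y * a \<in> scissor_ideal" for Y
    using subset_UNIV[of "Poly_Mapping.keys a"]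
  proof (induction a rule: frag_induction)
    case (diff f g)
    from scissor_ideal.diff[OF diff] show ?case by (simp add: algebra_simps)
  qed (simp_all add: scissor_ideal.zero single)
  show ?thesis
    using subset_UNIV[of "Poly_Mapping.keys b"]
  proof (induction b rule: frag_induction)
    case (diff f g)
    from scissor_ideal.diff[OF diff] show ?case by (simp add: algebra_simps)
  qed (simp_all add: scissor_ideal.zero left)
qed

quotient_type K0 = "variety \<Rightarrow>\<^sub>0 int" / "\<lambda>a b. a - b \<in> scissor_ideal"
proof (rule equivpI)
  show "reflp (\<lambda>a b. a - b \<in> scissor_ideal)"
    by (auto intro!: reflpI scissor_ideal.zero)
  show "symp (\<lambda>a b. a - b \<in> scissor_ideal)"
    using scissor_ideal_uminus by (fastforce intro: sympI)
  show "transp (\<lambda>a b. a - b \<in> scissor_ideal)"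
    using scissor_ideal_add by (fastforce intro: transpI)
qed

text \<open>
  The class \<open>comm_ring_1\<close> would require a proof of \<open>0 \<noteq> 1\<close>, i.e. the construction of an additive
  invariant of varieties. The ring structure itself does not need it.
\<close>

instantiation K0 :: comm_ring
begin

lift_definition zero_K0 :: K0 is 0 .

lift_definition plus_K0 :: "K0 \<Rightarrow> K0 \<Rightarrow> K0" is "(+)"
proof -
  fix a b c d :: "variety \<Rightarrow>\<^sub>0 int"
  assume "a - b \<in> scissor_ideal" "c - d \<in> scissor_ideal"
  from scissor_ideal_add[OF this] show "a + c - (b + d) \<in> scissor_ideal"
    by (simp add: algebra_simps)
qed

lift_definition uminus_K0 :: "K0 \<Rightarrow> K0" is uminus
  using scissor_ideal_uminus by fastforce

lift_definition minus_K0 :: "K0 \<Rightarrow> K0 \<Rightarrow> K0" is "(-)"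
proof -
  fix a b c d :: "variety \<Rightarrow>\<^sub>0 int"
  assume "a - b \<in> scissor_ideal" "c - d \<in> scissor_ideal"
  from scissor_ideal.diff[OF this] show "a - c - (b - d) \<in> scissor_ideal"
    by (simp add: algebra_simps)
qed

lift_definition times_K0 :: "K0 \<Rightarrow> K0 \<Rightarrow> K0" is "(*)"
proof -
  fix a b c d :: "variety \<Rightarrow>\<^sub>0 int"
  assume "a - b \<in> scissor_ideal" "c - d \<in> scissor_ideal"
  then have "(a - b) * c + b * (c - d) \<in> scissor_ideal"
    by (intro scissor_ideal_add scissor_ideal.mult_left scissor_ideal.mult_right)
  then show "a * c - b * d \<in> scissor_ideal" by (simp add: algebra_simps)
qed

instance
  by standard (transfer; simp add: algebra_simps scissor_ideal.zero scissor_ideal_commutator)+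

end

instantiation K0 :: comm_monoid_mult
begin

lift_definition one_K0 :: K0 is 1 .

instance
  by standard (transfer; simp add: scissor_ideal.zero)

end

lift_definition nat_K0 :: "nat \<Rightarrow> K0" is of_nat .

definition motivic_class :: "complex list set \<Rightarrow> K0" where
  "motivic_class X = abs_K0 (Poly_Mapping.single (Variety X) 1)"

definition lefschetz :: K0 where
  "lefschetz = motivic_class (affine_space 1)"

section \<open>Stability and abelian representations\<close>

text \<open>
  A finite quiver is a \<open>fin_digraph\<close>, in which loops and parallel arrows are allowed. Its lattice
  of dimension vectors consists of the \<open>\<alpha> :: 'v \<Rightarrow>\<^sub>0 int\<close> with support in the vertex set.
\<close>

definition stability_function ::
    "('v, 'e) pre_digraph \<Rightarrow> (('v \<Rightarrow>\<^sub>0 int) \<Rightarrow> complex) \<Rightarrow> bool" where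
  "stability_function Q Z \<longleftrightarrow>
     (\<forall>\<alpha> \<beta>. Poly_Mapping.keys \<alpha> \<subseteq> verts Q \<longrightarrow> Poly_Mapping.keys \<beta> \<subseteq> verts Q \<longrightarrow>
        Z (\<alpha> + \<beta>) = Z \<alpha> + Z \<beta>) \<and>
     (\<forall>i\<in>verts Q. \<exists>r \<phi>. 0 < r \<and> 0 < \<phi> \<and> \<phi> \<le> 1 \<and>
        Z (Poly_Mapping.single i 1) = complex_of_real r * exp (\<i> * complex_of_real (pi * \<phi>)))"

definition slope :: "(('v \<Rightarrow>\<^sub>0 int) \<Rightarrow> complex) \<Rightarrow> ('v \<Rightarrow>\<^sub>0 int) \<Rightarrow> ereal" where
  "slope Z \<alpha> = (if Im (Z \<alpha>) = 0 then \<infinity> else ereal (- Re (Z \<alpha>) / Im (Z \<alpha>)))"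

definition slope_set :: "(('v \<Rightarrow>\<^sub>0 int) \<Rightarrow> complex) \<Rightarrow> 'v set \<Rightarrow> ereal" where
  "slope_set Z I = slope Z (\<Sum>i\<in>I. Poly_Mapping.single i 1)"

text \<open>
  In an abelian representation the space at every vertex is the ground field, and the map along an
  arrow \<open>a\<close> is multiplication by the scalar \<open>x a\<close>. A family of subsets \<open>U\<close> only matters
  on the vertices of the quiver.
\<close>

definition subrepresentation ::
    "('v, 'e) pre_digraph \<Rightarrow> ('e \<Rightarrow> 'k::field) \<Rightarrow> ('v \<Rightarrow> 'k set) \<Rightarrow> bool" where
  "subrepresentation Q x U \<longleftrightarrow>
     (\<forall>i\<in>verts Q. vector_space_over_itself.subspace (U i)) \<and>
     (\<forall>a\<in>arcs Q. \<forall>u\<in>U (tail Q a). x a * u \<in> U (head Q a))"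

definition dimension_vector ::
    "('v, 'e) pre_digraph \<Rightarrow> ('v \<Rightarrow> 'k::field set) \<Rightarrow> 'v \<Rightarrow>\<^sub>0 int" where
  "dimension_vector Q U =
     (\<Sum>i\<in>verts Q. Poly_Mapping.single i (int (vector_space_over_itself.dim (U i))))"

definition nonzero_family :: "('v, 'e) pre_digraph \<Rightarrow> ('v \<Rightarrow> 'k::field set) \<Rightarrow> bool" where
  "nonzero_family Q U \<longleftrightarrow> (\<exists>i\<in>verts Q. U i \<noteq> {0})"

definition semistable_representation ::
    "('v, 'e) pre_digraph \<Rightarrow> (('v \<Rightarrow>\<^sub>0 int) \<Rightarrow> complex) \<Rightarrow> ('e \<Rightarrow> 'k::field) \<Rightarrow> bool" where
  "semistable_representation Q Z x \<longleftrightarrow>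
     (\<forall>U. subrepresentation Q x U \<and> nonzero_family Q U \<and> (\<exists>i\<in>verts Q. U i \<noteq> UNIV) \<longrightarrow>
        slope Z (dimension_vector Q U) \<le> slope Z (dimension_vector Q (\<lambda>_. UNIV :: 'k set)))"

definition indecomposable_representation ::
    "('v, 'e) pre_digraph \<Rightarrow> ('e \<Rightarrow> 'k::field) \<Rightarrow> bool" where
  "indecomposable_representation Q x \<longleftrightarrow>
     verts Q \<noteq> {} \<and>
     \<not> (\<exists>U W. subrepresentation Q x U \<and> subrepresentation Q x W \<and>
          nonzero_family Q U \<and> nonzero_family Q W \<and>
          (\<forall>i\<in>verts Q. U i \<inter> W i = {0} \<and> {u + w | u w. u \<in> U i \<and> w \<in> W i} = UNIV))"

text \<open>
  An enumeration of the arrows provides the coordinates on the affine space of abelian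
  representations; its choice does not change the isomorphism class of a subvariety.
\<close>

definition arc_list :: "('v, 'e) pre_digraph \<Rightarrow> 'e list" where
  "arc_list Q = (SOME es. distinct es \<and> set es = arcs Q)"

definition R_ind ::
    "('v, 'e) pre_digraph \<Rightarrow> (('v \<Rightarrow>\<^sub>0 int) \<Rightarrow> complex) \<Rightarrow> complex list set" where
  "R_ind Q Z = {map x (arc_list Q) | x.
     indecomposable_representation Q x \<and> semistable_representation Q Z x}"

definition torus :: "('v, 'e) pre_digraph \<Rightarrow> complex list set" where
  "torus Q = {xs \<in> affine_space (card (verts Q)). 0 \<notin> set xs}"

subsection \<open>The loci involved are quasi-affine varieties\<close>

lemma quasi_affine_open:
  assumes "F \<subseteq> poly_fun n"
  shows "quasi_affine {xs \<in> affine_space n. \<exists>f\<in>F. f xs \<noteq> 0}"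
proof -
  have "{xs \<in> affine_space n. \<exists>f\<in>F. f xs \<noteq> 0} =
      affine_space n - {xs \<in> affine_space n. \<forall>f\<in>F. f xs = 0}"
    by auto
  then show ?thesis
    using assms zariski_closed_affine_space unfolding quasi_affine_def zariski_closed_def by blast
qed

lemma quasi_affine_affine_space: "quasi_affine (affine_space n)"
  using quasi_affine_open[of "{\<lambda>_. 1}" n] by (simp add: poly_fun.const)

lemma quasi_affine_torus: "quasi_affine (torus Q)"
proof -
  let ?n = "card (verts Q)"
  have "(\<lambda>xs. \<Prod>i<?n. xs ! i) \<in> poly_fun ?n"
    by (intro poly_fun_prod) (auto intro: poly_fun.coord)
  then have "quasi_affine {xs \<in> affine_space ?n. \<exists>f\<in>{\<lambda>xs. \<Prod>i<?n. xs ! i}. f xs \<noteq> 0}"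
    by (intro quasi_affine_open) auto
  also have "{xs \<in> affine_space ?n. \<exists>f\<in>{\<lambda>xs. \<Prod>i<?n. xs ! i}. f xs \<noteq> 0} = torus Q"
    by (auto simp: torus_def affine_space_def in_set_conv_nth)
  finally show ?thesis .
qed

lemma subrepresentation_mono:
  assumes "fin_digraph Q" "subrepresentation Q y U" "\<And>a. a \<in> arcs Q \<Longrightarrow> y a = 0 \<Longrightarrow> x a = 0"
  shows "subrepresentation Q x U"
  unfolding subrepresentation_def
proof (intro conjI ballI)
  show "vector_space_over_itself.subspace (U i)" if "i \<in> verts Q" for i
    using assms(2) that by (simp add: subrepresentation_def)
  fix a u assume a: "a \<in> arcs Q" and u: "u \<in> U (tail Q a)"
  interpret fin_digraph Q by fact
  have sub: "vector_space_over_itself.subspace (U (head Q a))"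
    and yu: "y a * u \<in> U (head Q a)"
    using assms(2) a u by (auto simp: subrepresentation_def)
  have "x a * u = (x a / y a) * (y a * u)"
    using assms(3)[OF a] by auto
  then show "x a * u \<in> U (head Q a)"
    using vector_space_over_itself.subspace_scale[OF sub yu] by metis
qed

lemma quasi_affine_R_ind:
  fixes Q :: "('v, 'e) pre_digraph"
  assumes "fin_digraph Q"
  shows "quasi_affine (R_ind Q Z)"
proof -
  interpret fin_digraph Q by fact
  let ?es = "arc_list Q" and ?n = "length (arc_list Q)"
  have es: "distinct ?es" "set ?es = arcs Q"
    using someI_ex[of "\<lambda>es. distinct es \<and> set es = arcs Q"] finite_distinct_list[OF finite_arcs]
    unfolding arc_list_def by auto
  let ?good = "\<lambda>x. indecomposable_representation Q x \<and> semistable_representation Q Z x"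
  have mono: "?good y" if "?good x" "\<And>a. a \<in> arcs Q \<Longrightarrow> y a = 0 \<Longrightarrow> x a = 0"
    for x y :: "'e \<Rightarrow> complex"
    using that(1) subrepresentation_mono[OF assms, of y _ x] that(2)
    unfolding indecomposable_representation_def semistable_representation_def by meson
  define \<J> where "\<J> = {{j. j < ?n \<and> x (?es ! j) \<noteq> 0} | x :: 'e \<Rightarrow> complex. ?good x}"
  define F where "F = (\<lambda>J (xs :: complex list). \<Prod>j\<in>J. xs ! j) ` \<J>"
  have fin: "finite J" "J \<subseteq> {..<?n}" if "J \<in> \<J>" for J
    using that by (auto simp: \<J>_def)
  have "R_ind Q Z = {xs \<in> affine_space ?n. \<exists>f\<in>F. f xs \<noteq> 0}"
  proof (intro equalityI subsetI)
    fix xs assume "xs \<in> R_ind Q Z"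
    then obtain x where x: "xs = map x ?es" "?good x" unfolding R_ind_def by blast
    let ?J = "{j. j < ?n \<and> x (?es ! j) \<noteq> 0}"
    have "?J \<in> \<J>" using x unfolding \<J>_def by blast
    then have "(\<lambda>xs. \<Prod>j\<in>?J. xs ! j) \<in> F" unfolding F_def by (rule imageI)
    moreover have "(\<Prod>j\<in>?J. xs ! j) \<noteq> 0" using x by simp
    ultimately have "\<exists>f\<in>F. f xs \<noteq> 0" by (intro bexI)
    then show "xs \<in> {xs \<in> affine_space ?n. \<exists>f\<in>F. f xs \<noteq> 0}"
      using x(1) by (simp add: affine_space_def)
  next
    fix xs assume "xs \<in> {xs \<in> affine_space ?n. \<exists>f\<in>F. f xs \<noteq> 0}"
    then obtain J where J: "length xs = ?n" "J \<in> \<J>" "(\<Prod>j\<in>J. xs ! j) \<noteq> 0"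
      unfolding F_def affine_space_def by blast
    then obtain x :: "'e \<Rightarrow> complex" where x: "J = {j. j < ?n \<and> x (?es ! j) \<noteq> 0}" "?good x"
      unfolding \<J>_def by blast
    define y :: "'e \<Rightarrow> complex" where "y a = the (map_of (zip ?es xs) a)" for a
    have y: "y (?es ! j) = xs ! j" if "j < ?n" for j
      using that J(1) es(1) by (simp add: y_def map_of_zip_nth)
    have "?good y"
    proof (rule mono[OF x(2)])
      fix a assume "a \<in> arcs Q" "y a = 0"
      then obtain j where j: "j < ?n" "a = ?es ! j" using es(2) by (metis in_set_conv_nth)
      with \<open>y a = 0\<close> have "xs ! j = 0" using y by simp
      then have "j \<notin> J" using J(3) fin[OF J(2)] by auto
      then show "x a = 0" using j x(1) by simp
    qed
    moreover have "xs = map y ?es" using y J(1) by (intro nth_equalityI) auto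
    ultimately show "xs \<in> R_ind Q Z" unfolding R_ind_def by blast
  qed
  moreover have "F \<subseteq> poly_fun ?n"
    unfolding F_def using fin by (auto intro!: poly_fun_prod poly_fun.coord)
  ultimately show ?thesis using quasi_affine_open[of F ?n] by simp
qed

section \<open>The abelian invariant as a polynomial\<close>

definition semistable_subquiver ::
    "(('v \<Rightarrow>\<^sub>0 int) \<Rightarrow> complex) \<Rightarrow> ('v, 'e) pre_digraph \<Rightarrow> bool" where
  "semistable_subquiver Z G \<longleftrightarrow>
     (\<forall>I. I \<noteq> {} \<and> I \<subset> verts G \<and> \<not> (\<exists>a\<in>arcs G. tail G a \<in> I \<and> head G a \<in> verts G - I) \<longrightarrow>
        slope_set Z I \<le> slope_set Z (verts G))"

definition connected_semistable_subquivers ::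
    "('v, 'e) pre_digraph \<Rightarrow> (('v \<Rightarrow>\<^sub>0 int) \<Rightarrow> complex) \<Rightarrow> ('v, 'e) pre_digraph set" where
  "connected_semistable_subquivers Q Z =
     {G. spanning G Q \<and> Digraph_Component.connected G \<and> semistable_subquiver Z G}"

text \<open>The truncated subtraction is harmless: a connected graph has at least \<open>|G\<^sub>0| - 1\<close> arrows.\<close>

definition abelian_invariant ::
    "('v, 'e) pre_digraph \<Rightarrow> (('v \<Rightarrow>\<^sub>0 int) \<Rightarrow> complex) \<Rightarrow> int poly" where
  "abelian_invariant Q Z =
     (\<Sum>G\<in>connected_semistable_subquivers Q Z.
        [:- 1, 1:] ^ (card (arcs G) + 1 - card (verts G)))"

end

theory Submission
  imports Defs
begin

text \<open>
  Slopes enter only through a linear weight \<open>\<theta>\<close> on the vertices with total \<open>0\<close>: an arc set \<open>G\<close> is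
  semistable if and only if \<open>\<theta>(J) \<le> 0\<close> for all vertex sets \<open>J\<close> which no arrow of \<open>G\<close> leaves. By the
  max-flow min-cut theorem this says that \<open>G\<close> carries a non-negative flow with net outflow \<open>\<theta>\<close>, a
  picture which explains the argument below, although flows never occur in it.

  Positivity is proved for all real weights at once, by induction on the set of arrows. Choose an
  arrow \<open>a : i \<rightarrow> j\<close>. Removing arrows may destroy connectedness and semistability but never creates them.
  Hence the connected semistable \<open>G'\<close> which avoid \<open>a\<close> pair up with their \<open>G' \<union> {a}\<close>, and such a pair
  contributes \<open>(q-1)\<^sup>n + (q-1)\<^sup>n\<^sup>+\<^sup>1 = q (q-1)\<^sup>n\<close>, in total \<open>q\<close> times the invariant of the quiver without
  \<open>a\<close>. What is left are the \<open>G\<close> for which \<open>a\<close> is essential: \<open>G - a\<close> is no longer connected and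
  semistable. Among the vertex sets containing \<open>i\<close> but not \<open>j\<close> which no arrow of \<open>G - a\<close> leaves, let \<open>I\<close>
  be the smallest one of maximal weight \<open>\<lambda> = \<theta>(I) \<ge> 0\<close>; in terms of flows, \<open>\<lambda>\<close> is the least amount
  which has to pass through \<open>a\<close>, and \<open>I\<close> is a bottleneck. Let \<open>K\<close> be the connected component of \<open>j\<close>
  in the complement of \<open>I\<close>, and \<open>R\<close> the remaining vertices. Then \<open>G\<close> consists of \<open>a\<close> and of

  \<^item> a connected semistable arc set on \<open>I\<close> for \<open>\<theta>\<close> with \<open>\<lambda>\<close> subtracted at \<open>i\<close>, perturbed such that
    the minimality of \<open>I\<close> becomes part of semistability;
  \<^item> a connected semistable arc set on \<open>K\<close> for \<open>\<theta>\<close> with \<open>\<lambda>\<close> added at \<open>j\<close>;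
  \<^item> a connected semistable arc set on \<open>R \<union> {i}\<close>, where \<open>I\<close> is collapsed to the vertex \<open>i\<close> of weight
    \<open>0\<close>;
  \<^item> arrows from \<open>K\<close> to \<open>I\<close>, which are arbitrary if \<open>\<lambda> > 0\<close> and absent if \<open>\<lambda> = 0\<close>.

  Conversely all such data glue to an essential \<open>G\<close>, from which \<open>I\<close> and \<open>K\<close> can be recovered
  (\<open>essential_splits\<close>, \<open>split_essential\<close>, \<open>split_unique\<close>). The first Betti numbers add up, and a free
  choice among \<open>k\<close> arrows sums to \<open>q\<^sup>k\<close>. So the essential \<open>G\<close> contribute a sum of products of three
  smaller invariants and a power of \<open>q\<close> (\<open>sum_splits\<close>, \<open>deletion_recursion\<close>), and by induction all
  coefficients are non-negative (\<open>weight_invariant_nonneg\<close>).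

  The identity in the Grothendieck ring comes from stratifying the affine space of abelian
  representations by the set \<open>G\<close> of arrows with non-zero scalar. A stratum is a torus of class
  \<open>(L - 1)\<^sup>|\<^sup>G\<^sup>|\<close>, where \<open>L\<close> is the class of the affine line, and it belongs to the locus in question if and only if \<open>G\<close> is connected and semistable
  (\<open>motivic_class_R_ind\<close>).
\<close>

section \<open>Connected and semistable arc sets\<close>

definition successor_closed :: "('e \<Rightarrow> 'v) \<Rightarrow> ('e \<Rightarrow> 'v) \<Rightarrow> 'e set \<Rightarrow> 'v set \<Rightarrow> bool" where
  "successor_closed t h G J \<longleftrightarrow> (\<forall>b\<in>G. t b \<in> J \<longrightarrow> h b \<in> J)"

text \<open>
  Connectedness is phrased by cuts rather than by paths, because both gluing and dividing arc sets
  are then statements about vertex sets which no arrow crosses.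
\<close>

definition cut_connected :: "('e \<Rightarrow> 'v) \<Rightarrow> ('e \<Rightarrow> 'v) \<Rightarrow> 'v set \<Rightarrow> 'e set \<Rightarrow> bool" where
  "cut_connected t h V G \<longleftrightarrow>
     V \<noteq> {} \<and> (\<forall>J\<subseteq>V. (\<forall>b\<in>G. t b \<in> J \<longleftrightarrow> h b \<in> J) \<longrightarrow> J = {} \<or> J = V)"

definition weight_semistable ::
    "('e \<Rightarrow> 'v) \<Rightarrow> ('e \<Rightarrow> 'v) \<Rightarrow> 'v set \<Rightarrow> ('v \<Rightarrow> real) \<Rightarrow> 'e set \<Rightarrow> bool" where
  "weight_semistable t h V \<theta> G \<longleftrightarrow> (\<forall>J\<subseteq>V. successor_closed t h G J \<longrightarrow> sum \<theta> J \<le> 0)"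

definition semistable_arc_sets ::
    "('e \<Rightarrow> 'v) \<Rightarrow> ('e \<Rightarrow> 'v) \<Rightarrow> 'v set \<Rightarrow> 'e set \<Rightarrow> ('v \<Rightarrow> real) \<Rightarrow> 'e set set" where
  "semistable_arc_sets t h V A \<theta> =
     {G. G \<subseteq> A \<and> cut_connected t h V G \<and> weight_semistable t h V \<theta> G}"

definition weight_invariant ::
    "('e \<Rightarrow> 'v) \<Rightarrow> ('e \<Rightarrow> 'v) \<Rightarrow> 'v set \<Rightarrow> 'e set \<Rightarrow> ('v \<Rightarrow> real) \<Rightarrow> int poly" where
  "weight_invariant t h V A \<theta> =
     (\<Sum>G\<in>semistable_arc_sets t h V A \<theta>. [:- 1, 1:] ^ (card G + 1 - card V))"

lemma cut_connectedD:
  assumes "cut_connected t h V G" "J \<subseteq> V" "\<And>b. b \<in> G \<Longrightarrow> t b \<in> J \<longleftrightarrow> h b \<in> J"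
  shows "J = {} \<or> J = V"
  using assms unfolding cut_connected_def by simp

lemma cut_connectedI:
  assumes "V \<noteq> {}"
    and "\<And>J. J \<subseteq> V \<Longrightarrow> J \<noteq> {} \<Longrightarrow> J \<noteq> V \<Longrightarrow> (\<And>b. b \<in> G \<Longrightarrow> t b \<in> J \<longleftrightarrow> h b \<in> J) \<Longrightarrow> False"
  shows "cut_connected t h V G"
  unfolding cut_connected_def using assms by metis

section \<open>Polynomials with non-negative coefficients\<close>

definition nonneg_coeffs :: "int poly \<Rightarrow> bool" where
  "nonneg_coeffs p \<longleftrightarrow> (\<forall>k. coeff p k \<ge> 0)"

lemma nonneg_coeffs_1: "nonneg_coeffs 1"
  and nonneg_coeffs_X: "nonneg_coeffs [:0, 1:]"
  by (auto simp: nonneg_coeffs_def coeff_pCons split: nat.splits)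

lemma nonneg_coeffs_add: "nonneg_coeffs p \<Longrightarrow> nonneg_coeffs r \<Longrightarrow> nonneg_coeffs (p + r)"
  by (simp add: nonneg_coeffs_def)

lemma nonneg_coeffs_mult: "nonneg_coeffs p \<Longrightarrow> nonneg_coeffs r \<Longrightarrow> nonneg_coeffs (p * r)"
  by (simp add: nonneg_coeffs_def coeff_mult sum_nonneg)

lemma nonneg_coeffs_power: "nonneg_coeffs p \<Longrightarrow> nonneg_coeffs (p ^ n)"
  by (induction n) (simp_all add: nonneg_coeffs_1 nonneg_coeffs_mult)

lemma nonneg_coeffs_sum: "(\<And>x. x \<in> S \<Longrightarrow> nonneg_coeffs (f x)) \<Longrightarrow> nonneg_coeffs (sum f S)"
  by (simp add: nonneg_coeffs_def coeff_sum sum_nonneg)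

text \<open>
  This is the binomial theorem for \<open>((q - 1) + 1)\<^sup>k\<close>: the choice of an arbitrary subset of \<open>k\<close> arrows
  contributes the positive term \<open>q\<^sup>k\<close>.
\<close>

lemma sum_Pow_shifted_power:
  assumes "finite B"
  shows "(\<Sum>S\<in>Pow B. [:- 1, 1:] ^ card S) = ([:0, 1:] :: int poly) ^ card B"
proof -
  have "(\<Prod>b\<in>B. [:- 1, 1 :: int:] + 1) = (\<Sum>S\<in>Pow B. (\<Prod>b\<in>S. [:- 1, 1:]) * (\<Prod>b\<in>B - S. 1))"
    by (rule prod_add[OF assms])
  moreover have "[:- 1, 1 :: int:] + 1 = [:0, 1:]" by (simp add: one_pCons)
  ultimately show ?thesis by simp
qed

section \<open>Betti numbers and perturbed weights\<close>

text \<open>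
  A connected graph has non-negative first Betti number: take a largest vertex set which spans at
  least as many arrows as a tree on it; an arrow leaving it would enlarge it.
\<close>

lemma cut_connected_card:
  assumes "finite V" "finite G" and con: "cut_connected t h V G"
    and ends: "\<And>b. b \<in> G \<Longrightarrow> t b \<in> V \<and> h b \<in> V"
  shows "card V \<le> card G + 1"
proof -
  let ?in = "\<lambda>J. {b\<in>G. t b \<in> J \<and> h b \<in> J}"
  let ?P = "\<lambda>J. J \<subseteq> V \<and> J \<noteq> {} \<and> card J \<le> card (?in J) + 1"
  obtain v where "v \<in> V" using con by (auto simp: cut_connected_def)
  then have "?P {v}" by simp
  moreover have "\<forall>J. ?P J \<longrightarrow> card J < card V + 1"
    using card_mono[OF assms(1)] by (simp add: less_Suc_eq_le)
  ultimately obtain J where J: "?P J" and max: "\<And>J'. ?P J' \<Longrightarrow> card J' \<le> card J"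
    using ex_has_greatest_nat[of ?P "{v}" card "card V + 1"] by blast
  have finJ: "finite J" using J assms(1) finite_subset by blast
  have "J = V"
  proof (rule ccontr)
    assume "J \<noteq> V"
    then obtain b where b: "b \<in> G" "(t b \<in> J) \<noteq> (h b \<in> J)"
      using con J unfolding cut_connected_def by blast
    define v where "v = (if t b \<in> J then h b else t b)"
    have v: "v \<notin> J" "v \<in> V" "t b \<in> insert v J" "h b \<in> insert v J"
      using b ends[OF b(1)] by (auto simp: v_def)
    have "insert b (?in J) \<subseteq> ?in (insert v J)" "b \<notin> ?in J" using b v by auto
    then have "card (?in J) + 1 \<le> card (?in (insert v J))"
      using card_mono[of "?in (insert v J)" "insert b (?in J)"] assms(2) by simp
    then have "?P (insert v J)" using J v finJ by simp
    then have "card (insert v J) \<le> card J" by (rule max)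
    then show False using v finJ by simp
  qed
  then have "card V \<le> card (?in V) + 1" using J by simp
  also have "\<dots> \<le> card G + 1" using assms(2) by (simp add: card_mono)
  finally show ?thesis .
qed

lemma semistable_arc_sets_finite: "finite A \<Longrightarrow> finite (semistable_arc_sets t h V A \<theta>)"
  by (rule finite_subset[of _ "Pow A"]) (auto simp: semistable_arc_sets_def)

lemma semistable_arc_sets_card:
  assumes "finite V" "finite A" "\<And>b. b \<in> A \<Longrightarrow> t b \<in> V \<and> h b \<in> V"
    and "G \<in> semistable_arc_sets t h V A \<theta>"
  shows "finite G" "card V \<le> card G + 1"
proof -
  have G: "G \<subseteq> A" "cut_connected t h V G" using assms(4) by (auto simp: semistable_arc_sets_def)
  show "finite G" using G(1) assms(2) by (rule finite_subset)
  then show "card V \<le> card G + 1"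
    using cut_connected_card[OF assms(1) _ G(2)] assms(3) G(1) by blast
qed

text \<open>
  After the weight of \<open>i\<close> is changed such that \<open>I\<close> has total weight \<open>0\<close>, a small multiple of the weight
  with value \<open>|I| - 1\<close> at \<open>i\<close> and \<open>-1\<close> elsewhere is added. This turns the non-strict inequalities for the
  sets containing \<open>i\<close> into strict ones and does not affect the others. Hence semistability with such
  mixed inequalities is again semistability for a weight.
\<close>

lemma rooted_strict_weight:
  fixes \<theta> :: "'v \<Rightarrow> real"
  assumes fin: "finite I" and i: "i \<in> I"
  shows "\<exists>\<eta> :: 'v \<Rightarrow> real. sum \<eta> I = 0 \<and>
    (\<forall>J\<subseteq>I. sum \<eta> J \<le> 0 \<longleftrightarrow> (if i \<in> J then sum \<theta> J < sum \<theta> I \<or> J = I else sum \<theta> J \<le> 0))"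
proof -
  define l where "l = sum \<theta> I"
  define X where "X = {x \<in> (\<lambda>J. \<bar>sum \<theta> J\<bar>) ` Pow I \<union> (\<lambda>J. \<bar>sum \<theta> J - l\<bar>) ` Pow I. x > 0}"
  define e where "e = Min (insert 1 X) / (2 * (real (card I) + 1))"
  have finX: "finite X" using fin by (simp add: X_def)
  have "Min (insert 1 X) > 0" using finX by (auto simp: X_def)
  then have e: "e > 0" by (simp add: e_def)
  have small: "e * real n < x" if "x \<in> X" "n \<le> card I" for x n
  proof -
    have "e * real n < e * (2 * (real (card I) + 1))"
      using e that(2) by (intro mult_strict_left_mono) auto
    also have "\<dots> = Min (insert 1 X)" unfolding e_def by simp
    also have "\<dots> \<le> x" using finX that(1) by (intro Min_le) auto
    finally show ?thesis .
  qed
  define \<eta> where "\<eta> k = (\<theta> k - e) + (if k = i then e * real (card I) - l else 0)" for k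
  have sum_eta: "sum \<eta> J = sum \<theta> J - e * real (card J) +
      (if i \<in> J then e * real (card I) - l else 0)" if "J \<subseteq> I" for J
    using finite_subset[OF that fin] by (simp add: \<eta>_def sum.distrib sum_subtractf)
  \<comment> \<open>\<open>e\<close> times a cardinality stays below every positive value in \<open>X\<close>, so the sign of a non-zero
      unperturbed sum decides, and the perturbation decides only if that sum vanishes.\<close>
  have "sum \<eta> J \<le> 0 \<longleftrightarrow> (if i \<in> J then sum \<theta> J < l \<or> J = I else sum \<theta> J \<le> 0)"
    if J: "J \<subseteq> I" for J
  proof (cases "i \<in> J")
    case True
    have card: "card J \<le> card I" "J \<noteq> I \<Longrightarrow> card J < card I"
      using J fin by (simp_all add: card_mono psubset_card_mono psubset_eq)
    have eq: "sum \<eta> J = sum \<theta> J - l + e * real (card I - card J)"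
      using True card(1) by (simp add: sum_eta[OF J] of_nat_diff algebra_simps)
    show ?thesis
    proof (cases "J = I")
      case True
      then show ?thesis using eq i by (simp add: l_def)
    next
      case False
      have "e * real (card I - card J) > 0" using e card(2)[OF False] by simp
      moreover have "e * real (card I - card J) < l - sum \<theta> J" if "sum \<theta> J < l"
      proof -
        have "\<bar>sum \<theta> J - l\<bar> \<in> X"
          unfolding X_def using that J by (intro CollectI conjI UnI2 imageI) auto
        from small[OF this, of "card I - card J"] that show ?thesis by simp
      qed
      ultimately show ?thesis using eq True False by (smt (verit))
    qed
  next
    case False
    have "e * real (card J) \<ge> 0" using e by simp
    moreover have "e * real (card J) < sum \<theta> J" if "sum \<theta> J > 0"
    proof -
      have "\<bar>sum \<theta> J\<bar> \<in> X"
        unfolding X_def using that J by (intro CollectI conjI UnI1 imageI) auto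
      from small[OF this, of "card J"] that card_mono[OF fin J] show ?thesis by simp
    qed
    ultimately show ?thesis using False sum_eta[OF J] by (smt (verit))
  qed
  moreover have "sum \<eta> I = 0" using sum_eta[of I] i by (simp add: l_def)
  ultimately have *: "sum \<eta> I = 0 \<and>
    (\<forall>J\<subseteq>I. sum \<eta> J \<le> 0 \<longleftrightarrow> (if i \<in> J then sum \<theta> J < sum \<theta> I \<or> J = I else sum \<theta> J \<le> 0))"
    by (simp add: l_def)
  show ?thesis
  proof
    show "sum \<eta> I = 0 \<and>
      (\<forall>J\<subseteq>I. sum \<eta> J \<le> 0 \<longleftrightarrow> (if i \<in> J then sum \<theta> J < sum \<theta> I \<or> J = I else sum \<theta> J \<le> 0))"
      by (fact *)
  qed
qed

lemma sum_times:
  fixes f :: "'x \<Rightarrow> 'r :: comm_semiring_0" and g :: "'y \<Rightarrow> 'r"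
  shows "(\<Sum>(x, y)\<in>B \<times> C. f x * g y) = sum f B * sum g C"
  by (simp add: sum_product sum.cartesian_product)

section \<open>Arc sets for which an arrow is essential\<close>

text \<open>
  The setting of one step of the induction: a quiver with vertices \<open>V\<close> and arrows \<open>A\<close>, a weight of total
  \<open>0\<close>, and the arrow \<open>a\<close> from \<open>i = t a\<close> to \<open>j = h a\<close> which is to be deleted.
\<close>

locale arrow_deletion =
  fixes t h :: "'e \<Rightarrow> 'v" and V :: "'v set" and A :: "'e set" and \<theta> :: "'v \<Rightarrow> real" and a :: 'e
  assumes finV: "finite V" and finA: "finite A"
    and ends: "b \<in> A \<Longrightarrow> t b \<in> V \<and> h b \<in> V"
    and total: "sum \<theta> V = 0"
    and a: "a \<in> A"
begin

definition inner_arcs :: "'v set \<Rightarrow> 'e set" where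
  "inner_arcs J = {b\<in>A. t b \<in> J \<and> h b \<in> J}"

definition cross_arcs :: "'v set \<Rightarrow> 'v set \<Rightarrow> 'e set" where
  "cross_arcs I K = {b\<in>A. t b \<in> K \<and> h b \<in> I}"

definition rest_arcs :: "'v set \<Rightarrow> 'v set \<Rightarrow> 'e set" where
  "rest_arcs I K = {b\<in>A. t b \<in> V - I - K \<and> h b \<in> V - K}"

text \<open>
  The vertices of \<open>I\<close> are collapsed to \<open>t a\<close>. Tails need no change, since the arrows concerned start
  outside \<open>I\<close>.
\<close>

definition collapsed_head :: "'v set \<Rightarrow> 'e \<Rightarrow> 'v" where
  "collapsed_head I b = (if h b \<in> I then t a else h b)"

text \<open>
  A weight as provided by \<open>rooted_strict_weight\<close>; semistability for it makes \<open>I\<close> the only heaviest closed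
  subset of \<open>I\<close> which contains \<open>t a\<close>.
\<close>

definition strict_weight :: "'v set \<Rightarrow> 'v \<Rightarrow> real" where
  "strict_weight I = (SOME \<eta>. sum \<eta> I = 0 \<and>
    (\<forall>J\<subseteq>I. sum \<eta> J \<le> 0 \<longleftrightarrow>
      (if t a \<in> J then sum \<theta> J < sum \<theta> I \<or> J = I else sum \<theta> J \<le> 0)))"

definition source_pieces where
  "source_pieces I = semistable_arc_sets t h I (inner_arcs I) (strict_weight I)"

definition target_pieces where
  "target_pieces I K =
     semistable_arc_sets t h K (inner_arcs K) (\<theta>(h a := \<theta> (h a) + sum \<theta> I))"

definition rest_pieces where
  "rest_pieces I K = semistable_arc_sets t (collapsed_head I) (insert (t a) (V - I - K))
     (rest_arcs I K) (\<theta>(t a := 0))"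

text \<open>
  If \<open>\<theta>(I) = 0\<close>, then an arrow from \<open>K\<close> to \<open>I\<close> would keep everything connected and semistable after the
  removal of \<open>a\<close>, so that \<open>a\<close> would not be essential.
\<close>

definition cross_pieces where
  "cross_pieces I K = (if sum \<theta> I = 0 then {{}} else Pow (cross_arcs I K))"

definition splittings :: "('v set \<times> 'v set) set" where
  "splittings = {(I, K). I \<subseteq> V \<and> K \<subseteq> V \<and> I \<inter> K = {} \<and> t a \<in> I \<and> h a \<in> K \<and>
     sum \<theta> I \<ge> 0 \<and> sum \<theta> K = - sum \<theta> I}"

definition splits :: "'e set \<Rightarrow> 'v set \<Rightarrow> 'v set \<Rightarrow> bool" where
  "splits G I K \<longleftrightarrow> (I, K) \<in> splittings \<and> a \<in> G \<and>
     G \<subseteq> insert a (inner_arcs I \<union> inner_arcs K \<union> rest_arcs I K \<union> cross_arcs I K) \<and>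
     G \<inter> inner_arcs I \<in> source_pieces I \<and> G \<inter> inner_arcs K \<in> target_pieces I K \<and>
     G \<inter> rest_arcs I K \<in> rest_pieces I K \<and> G \<inter> cross_arcs I K \<in> cross_pieces I K"

definition essential :: "'e set set" where
  "essential = {G \<in> semistable_arc_sets t h V A \<theta>. a \<in> G \<and>
     G - {a} \<notin> semistable_arc_sets t h V (A - {a}) \<theta>}"

lemma strict_weight:
  assumes "I \<subseteq> V" "t a \<in> I"
  shows "sum (strict_weight I) I = 0"
    and "J \<subseteq> I \<Longrightarrow> sum (strict_weight I) J \<le> 0 \<longleftrightarrow>
      (if t a \<in> J then sum \<theta> J < sum \<theta> I \<or> J = I else sum \<theta> J \<le> 0)"
proof -
  have "finite I" using assms finV finite_subset by blast
  from someI_ex[OF rooted_strict_weight[OF this assms(2), of \<theta>]]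
  have "sum (strict_weight I) I = 0 \<and> (\<forall>J\<subseteq>I. sum (strict_weight I) J \<le> 0 \<longleftrightarrow>
      (if t a \<in> J then sum \<theta> J < sum \<theta> I \<or> J = I else sum \<theta> J \<le> 0))"
    unfolding strict_weight_def .
  then show "sum (strict_weight I) I = 0"
    and "J \<subseteq> I \<Longrightarrow> sum (strict_weight I) J \<le> 0 \<longleftrightarrow>
      (if t a \<in> J then sum \<theta> J < sum \<theta> I \<or> J = I else sum \<theta> J \<le> 0)"
    by blast+
qed

lemma sum_target_weight:
  assumes "J \<subseteq> V"
  shows "sum (\<theta>(h a := \<theta> (h a) + c)) J = sum \<theta> J + (if h a \<in> J then c else 0)"
proof -
  have fin: "finite J" using assms finV finite_subset by blast
  have "sum (\<theta>(h a := \<theta> (h a) + c)) J = (\<Sum>k\<in>J. \<theta> k + (if k = h a then c else 0))"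
    by (rule sum.cong) auto
  then show ?thesis using fin by (simp add: sum.distrib)
qed

lemma sum_rest_weight:
  assumes "J \<subseteq> V" "t a \<notin> J"
  shows "sum (\<theta>(t a := 0)) J = sum \<theta> J" "sum (\<theta>(t a := 0)) (insert (t a) J) = sum \<theta> J"
proof -
  have fin: "finite J" using assms finV finite_subset by blast
  show "sum (\<theta>(t a := 0)) J = sum \<theta> J" using assms(2) by (intro sum.cong) auto
  then show "sum (\<theta>(t a := 0)) (insert (t a) J) = sum \<theta> J" using fin assms(2) by simp
qed

lemma sum_Un: "I \<subseteq> V \<Longrightarrow> J \<subseteq> V \<Longrightarrow> I \<inter> J = {} \<Longrightarrow> sum \<theta> (I \<union> J) = sum \<theta> I + sum \<theta> J"
  using finV by (meson finite_subset sum.union_disjoint)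

text \<open>
  A set which no arrow crosses contains each of the three connected pieces entirely or not at all;
  the rest is tied to \<open>I\<close> through the vertex \<open>t a\<close>, and the arrow \<open>b\<close> ties \<open>K\<close> to \<open>I\<close>.
\<close>

lemma glued_connected:
  assumes IK: "I \<subseteq> V" "K \<subseteq> V" "I \<inter> K = {}" "t a \<in> I"
    and conI: "cut_connected t h I (G \<inter> inner_arcs I)"
    and conK: "cut_connected t h K (G \<inter> inner_arcs K)"
    and conR: "cut_connected t (collapsed_head I) (insert (t a) (V - I - K)) (G \<inter> rest_arcs I K)"
    and b: "b \<in> G" "t b \<in> I \<and> h b \<in> K \<or> t b \<in> K \<and> h b \<in> I"
  shows "cut_connected t h V G"
  unfolding cut_connected_def
proof (intro conjI allI impI)
  show "V \<noteq> {}" using IK by auto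
  fix M assume M: "M \<subseteq> V" and nc: "\<forall>b\<in>G. t b \<in> M \<longleftrightarrow> h b \<in> M"
  have I: "M \<inter> I = {} \<or> M \<inter> I = I"
    by (rule cut_connectedD[OF conI]) (use nc in \<open>auto simp: inner_arcs_def\<close>)
  have K: "M \<inter> K = {} \<or> M \<inter> K = K"
    by (rule cut_connectedD[OF conK]) (use nc in \<open>auto simp: inner_arcs_def\<close>)
  let ?R = "V - I - K"
  define M' where "M' = M \<inter> insert (t a) ?R"
  have "t b \<in> M' \<longleftrightarrow> collapsed_head I b \<in> M'" if "b \<in> G \<inter> rest_arcs I K" for b
  proof -
    have "t b \<in> ?R" "h b \<in> V - K" "t b \<in> M \<longleftrightarrow> h b \<in> M" using that nc by (auto simp: rest_arcs_def)
    then show ?thesis using I IK by (auto simp: M'_def collapsed_head_def)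
  qed
  moreover have "M' \<subseteq> insert (t a) ?R" by (auto simp: M'_def)
  ultimately have R: "M' = {} \<or> M' = insert (t a) ?R"
    by (intro cut_connectedD[OF conR]) auto
  have bM: "t b \<in> M \<longleftrightarrow> h b \<in> M" using b(1) nc by blast
  show "M = {} \<or> M = V"
  proof (cases "t a \<in> M")
    case True
    then have "I \<subseteq> M" using I IK by blast
    have "t a \<in> M'" using True by (simp add: M'_def)
    then have "M' = insert (t a) ?R" using R by blast
    then have "?R \<subseteq> M" unfolding M'_def by blast
    moreover have "K \<subseteq> M" using K b(2) bM \<open>I \<subseteq> M\<close> by blast
    ultimately show ?thesis using M \<open>I \<subseteq> M\<close> by blast
  next
    case False
    then have "M \<inter> I = {}" using I IK by blast
    have "t a \<notin> M'" using False by (simp add: M'_def)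
    then have "M \<inter> ?R = {}" using R unfolding M'_def by blast
    moreover have "M \<inter> K = {}" using K b(2) bM \<open>M \<inter> I = {}\<close> by blast
    ultimately show ?thesis using M \<open>M \<inter> I = {}\<close> by blast
  qed
qed

text \<open>
  In the next lemmas \<open>G\<close> is glued from pieces on \<open>I\<close>, \<open>K\<close> and the remaining vertices.
\<close>

context
  fixes G I K
  assumes split: "splits G I K"
begin

lemma split_sets: "I \<subseteq> V" "K \<subseteq> V" "I \<inter> K = {}" "t a \<in> I" "h a \<in> K" "sum \<theta> I \<ge> 0"
    "sum \<theta> K = - sum \<theta> I" "a \<in> G"
  using split by (auto simp: splits_def splittings_def)

lemma split_arcs:
  assumes "b \<in> G" "b \<noteq> a"
  shows "b \<in> A" "t b \<in> I \<Longrightarrow> h b \<in> I" "t b \<in> K \<Longrightarrow> h b \<in> I \<union> K"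
    "t b \<in> V - I - K \<Longrightarrow> h b \<in> V - K"
  using assms split split_sets(1-3)
  unfolding splits_def inner_arcs_def cross_arcs_def rest_arcs_def by blast+

lemma split_source_closed: "successor_closed t h (G - {a}) I"
  using split_arcs by (auto simp: successor_closed_def)

text \<open>
  Everything about a glued arc set follows from here. No arrow except \<open>a\<close> leaves \<open>I\<close>, or connects \<open>K\<close> and
  the rest, so a closed set meets every piece in a closed set, and semistability of the pieces bounds
  the three contributions to its weight.
\<close>

lemma split_bounds:
  assumes L: "L \<subseteq> V" "successor_closed t h (G - {a}) L"
  shows "t a \<in> L \<Longrightarrow> sum \<theta> (L \<inter> I) < sum \<theta> I \<or> I \<subseteq> L"
    "t a \<in> L \<Longrightarrow> sum \<theta> (L \<inter> I) \<le> sum \<theta> I"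
    "t a \<notin> L \<Longrightarrow> sum \<theta> (L \<inter> I) \<le> 0"
    "sum \<theta> (L \<inter> K) \<le> (if h a \<in> L then - sum \<theta> I else 0)"
    "sum \<theta> (L \<inter> (V - I - K)) \<le> 0"
    "sum \<theta> L = sum \<theta> (L \<inter> I) + sum \<theta> (L \<inter> K) + sum \<theta> (L \<inter> (V - I - K))"
proof -
  note s = split_sets
  have a_notin: "a \<notin> inner_arcs I" "a \<notin> inner_arcs K" "a \<notin> rest_arcs I K"
    using s by (auto simp: inner_arcs_def rest_arcs_def)
  have "successor_closed t h (G \<inter> inner_arcs I) (L \<inter> I)"
    using L(2) a_notin by (auto simp: successor_closed_def inner_arcs_def)
  then have "sum (strict_weight I) (L \<inter> I) \<le> 0"
    using split unfolding splits_def source_pieces_def semistable_arc_sets_def weight_semistable_def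
    by simp
  then have *: "if t a \<in> L \<inter> I then sum \<theta> (L \<inter> I) < sum \<theta> I \<or> L \<inter> I = I else sum \<theta> (L \<inter> I) \<le> 0"
    by (subst (asm) strict_weight(2)) (use s in auto)
  show "t a \<in> L \<Longrightarrow> sum \<theta> (L \<inter> I) < sum \<theta> I \<or> I \<subseteq> L"
    "t a \<in> L \<Longrightarrow> sum \<theta> (L \<inter> I) \<le> sum \<theta> I"
    "t a \<notin> L \<Longrightarrow> sum \<theta> (L \<inter> I) \<le> 0"
    using * s(4) by (auto split: if_splits)
  have "successor_closed t h (G \<inter> inner_arcs K) (L \<inter> K)"
    using L(2) a_notin by (auto simp: successor_closed_def inner_arcs_def)
  then have "sum (\<theta>(h a := \<theta> (h a) + sum \<theta> I)) (L \<inter> K) \<le> 0"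
    using split unfolding splits_def target_pieces_def semistable_arc_sets_def weight_semistable_def
    by simp
  then show "sum \<theta> (L \<inter> K) \<le> (if h a \<in> L then - sum \<theta> I else 0)"
    by (subst (asm) sum_target_weight) (use s L in \<open>auto split: if_splits\<close>)
  let ?R = "V - I - K"
  have "successor_closed t (collapsed_head I) (G \<inter> rest_arcs I K) (insert (t a) (L \<inter> ?R))"
    using L(2) a_notin s(4) by (auto simp: successor_closed_def rest_arcs_def collapsed_head_def)
  moreover have "insert (t a) (L \<inter> ?R) \<subseteq> insert (t a) ?R" by auto
  ultimately have "sum (\<theta>(t a := 0)) (insert (t a) (L \<inter> ?R)) \<le> 0"
    using split unfolding splits_def rest_pieces_def semistable_arc_sets_def weight_semistable_def
    by blast
  then show "sum \<theta> (L \<inter> ?R) \<le> 0"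
    by (subst (asm) sum_rest_weight(2)) (use s L in auto)
  have "L = (L \<inter> I \<union> L \<inter> K) \<union> L \<inter> ?R" using L(1) by blast
  then have "sum \<theta> L = sum \<theta> ((L \<inter> I \<union> L \<inter> K) \<union> L \<inter> ?R)" by simp
  also have "\<dots> = sum \<theta> (L \<inter> I \<union> L \<inter> K) + sum \<theta> (L \<inter> ?R)" by (rule sum_Un) (use L s in auto)
  also have "sum \<theta> (L \<inter> I \<union> L \<inter> K) = sum \<theta> (L \<inter> I) + sum \<theta> (L \<inter> K)"
    by (rule sum_Un) (use L s in auto)
  finally show "sum \<theta> L = sum \<theta> (L \<inter> I) + sum \<theta> (L \<inter> K) + sum \<theta> (L \<inter> ?R)" .
qed

text \<open>
  The bounds for the pieces add up to \<open>\<theta>(L) \<le> 0\<close> unless \<open>L\<close> contains \<open>t a\<close> but not \<open>h a\<close>, which \<open>a\<close> forbids.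
  Without \<open>a\<close>, semistability fails at \<open>I\<close> if \<open>\<theta>(I) > 0\<close>, and \<open>K\<close> is cut off if \<open>\<theta>(I) = 0\<close>.
\<close>

lemma split_essential: "G \<in> essential"
proof -
  note s = split_sets
  have con: "cut_connected t h V G"
    using split s unfolding splits_def source_pieces_def target_pieces_def rest_pieces_def
      semistable_arc_sets_def by (intro glued_connected[of I K G a]) auto
  have sst: "weight_semistable t h V \<theta> G"
    unfolding weight_semistable_def
  proof (intro allI impI)
    fix L assume L: "L \<subseteq> V" "successor_closed t h G L"
    have L': "successor_closed t h (G - {a}) L" using L(2) by (auto simp: successor_closed_def)
    have "t a \<in> L \<longrightarrow> h a \<in> L" using L(2) s by (auto simp: successor_closed_def)
    then show "sum \<theta> L \<le> 0" using split_bounds[OF L(1) L'] s(6) by (cases "t a \<in> L"; cases "h a \<in> L") auto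
  qed
  have "G \<subseteq> A" using split_arcs(1) a by blast
  have "G - {a} \<notin> semistable_arc_sets t h V (A - {a}) \<theta>"
  proof (cases "sum \<theta> I = 0")
    case False
    then have "\<not> sum \<theta> I \<le> 0" using s(6) by simp
    then have "\<not> weight_semistable t h V \<theta> (G - {a})"
      using s(1) split_source_closed unfolding weight_semistable_def by blast
    then show ?thesis by (simp add: semistable_arc_sets_def)
  next
    case True
    then have no: "G \<inter> cross_arcs I K = {}" using split by (auto simp: splits_def cross_pieces_def)
    have "t b \<in> K \<longleftrightarrow> h b \<in> K" if "b \<in> G - {a}" for b
    proof -
      have "b \<in> G" "b \<noteq> a" using that by auto
      note b = split_arcs[OF this]
      have "\<not> (t b \<in> K \<and> h b \<in> I)" using no b(1) that by (auto simp: cross_arcs_def)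
      then show ?thesis using b s ends[OF b(1)] by blast
    qed
    moreover have "K \<noteq> {}" "K \<noteq> V" using s by auto
    ultimately have "\<not> cut_connected t h V (G - {a})"
      using s(2) unfolding cut_connected_def by blast
    then show ?thesis by (simp add: semistable_arc_sets_def)
  qed
  then show ?thesis using con sst \<open>G \<subseteq> A\<close> s(8) by (simp add: essential_def semistable_arc_sets_def)
qed

end

text \<open>
  For a glued arc set, \<open>I\<close> is the smallest of the heaviest closed sets which contain \<open>t a\<close> but not
  \<open>h a\<close>, so it depends on \<open>G\<close> only.
\<close>

lemma split_source_le:
  assumes "splits G I K" "splits G I' K'"
  shows "sum \<theta> I' \<le> sum \<theta> I" "sum \<theta> I' = sum \<theta> I \<Longrightarrow> I \<subseteq> I'"
proof -
  note s' = split_sets[OF assms(2)]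
  have "h a \<notin> I'" using s' by auto
  note b = split_bounds[OF assms(1) s'(1) split_source_closed[OF assms(2)]]
  show "sum \<theta> I' \<le> sum \<theta> I" using b(2,4-6) s'(4) \<open>h a \<notin> I'\<close> by simp
  show "I \<subseteq> I'" if "sum \<theta> I' = sum \<theta> I"
    using b(1,4-6) s'(4) \<open>h a \<notin> I'\<close> that by auto
qed

text \<open>
  For given \<open>I\<close>, the set \<open>K\<close> is the connected component of \<open>h a\<close> in the complement of \<open>I\<close>.
\<close>

lemma split_target_le:
  assumes "splits G I K" "splits G I K'"
  shows "K \<subseteq> K'"
proof -
  note s = split_sets[OF assms(1)] and s' = split_sets[OF assms(2)]
  have con: "cut_connected t h K (G \<inter> inner_arcs K)"
    using assms(1) by (simp add: splits_def target_pieces_def semistable_arc_sets_def)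
  have "t b \<in> K \<inter> K' \<longleftrightarrow> h b \<in> K \<inter> K'" if b: "b \<in> G \<inter> inner_arcs K" for b
  proof -
    have "b \<noteq> a" "t b \<in> K" "h b \<in> K" using b s by (auto simp: inner_arcs_def)
    then show ?thesis using split_arcs(3,4)[OF assms(2), of b] b s by blast
  qed
  then have "K \<inter> K' = {} \<or> K \<inter> K' = K"
    by (intro cut_connectedD[OF con]) auto
  then show ?thesis using s s' by blast
qed

lemma split_unique:
  assumes "splits G I K" "splits G I' K'"
  shows "I = I' \<and> K = K'"
proof -
  have "sum \<theta> I' = sum \<theta> I"
    using split_source_le(1)[OF assms] split_source_le(1)[OF assms(2,1)] by simp
  then have I: "I = I'"
    using split_source_le(2)[OF assms] split_source_le(2)[OF assms(2,1)] by simp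
  have "K = K'"
    using split_target_le[of G I K K'] split_target_le[of G I K' K] assms unfolding I by simp
  with I show ?thesis ..
qed

text \<open>
  If semistability is lost, a closed set of positive weight appears, and only \<open>a\<close> can have left it.
  If only connectedness is lost, both sides of the cut are closed, so their weights are
  non-positive with sum \<open>0\<close>; the side containing \<open>t a\<close> has weight \<open>0\<close>.
\<close>

lemma essential_cut:
  assumes G: "G \<in> essential"
  shows "\<exists>J\<subseteq>V. successor_closed t h (G - {a}) J \<and> t a \<in> J \<and> h a \<notin> J \<and> sum \<theta> J \<ge> 0"
proof -
  have con: "cut_connected t h V G" and sst: "weight_semistable t h V \<theta> G"
    and GA: "G \<subseteq> A" "a \<in> G" and not: "G - {a} \<notin> semistable_arc_sets t h V (A - {a}) \<theta>"
    using G by (auto simp: essential_def semistable_arc_sets_def)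
  show ?thesis
  proof (cases "weight_semistable t h V \<theta> (G - {a})")
    case False
    then obtain J where J: "J \<subseteq> V" "successor_closed t h (G - {a}) J" "\<not> sum \<theta> J \<le> 0"
      unfolding weight_semistable_def by blast
    then have "\<not> successor_closed t h G J" using sst unfolding weight_semistable_def by blast
    then have "t a \<in> J" "h a \<notin> J" using J(2) by (auto simp: successor_closed_def)
    then show ?thesis using J by (intro exI[of _ J]) auto
  next
    case True
    then have "\<not> cut_connected t h V (G - {a})"
      using not GA by (auto simp: semistable_arc_sets_def)
    then obtain J where J: "J \<subseteq> V" "J \<noteq> {}" "J \<noteq> V" "\<And>b. b \<in> G - {a} \<Longrightarrow> t b \<in> J \<longleftrightarrow> h b \<in> J"
      using con unfolding cut_connected_def by auto
    define M where "M = (if t a \<in> J then J else V - J)"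
    have ends': "t b \<in> V \<and> h b \<in> V" if "b \<in> G" for b using that GA ends by blast
    have "\<exists>b\<in>G. (t b \<in> J) \<noteq> (h b \<in> J)"
      using con J(1-3) unfolding cut_connected_def by metis
    then have cross: "(t a \<in> J) \<noteq> (h a \<in> J)" using J(4) by blast
    have "successor_closed t h (G - {a}) J" "successor_closed t h (G - {a}) (V - J)"
      using J(4) ends' by (auto simp: successor_closed_def)
    then have "sum \<theta> J \<le> 0" "sum \<theta> (V - J) \<le> 0" "successor_closed t h (G - {a}) M"
      using True J(1) by (auto simp: weight_semistable_def M_def)
    moreover have "sum \<theta> J + sum \<theta> (V - J) = 0"
      using sum.subset_diff[OF J(1) finV, of \<theta>] total by simp
    ultimately have "successor_closed t h (G - {a}) M" "sum \<theta> M = 0" by (auto simp: M_def)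
    moreover have "M \<subseteq> V" "t a \<in> M" "h a \<notin> M"
      using J(1) cross ends'[OF GA(2)] by (auto simp: M_def)
    ultimately show ?thesis by (intro exI[of _ M]) auto
  qed
qed

text \<open>
  The bottleneck \<open>I\<close> is a smallest heaviest set among the candidates \<open>\<L>\<close>, and \<open>K\<close> is the smallest
  set of vertices around \<open>h a\<close> which is not linked to the rest of the complement of \<open>I\<close>. The conditions
  on the pieces are read off from \<open>G\<close> as follows: a closed set of a piece yields, possibly after
  uniting it with \<open>I\<close>, either a closed set of \<open>G\<close>, whose weight is at most \<open>0\<close>, or a member of \<open>\<L>\<close>, whose
  weight is at most that of \<open>I\<close>.
\<close>

lemma essential_splits:
  assumes G: "G \<in> essential"
  shows "\<exists>I K. splits G I K"
proof -
  have con: "cut_connected t h V G" and sst: "weight_semistable t h V \<theta> G"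
    and GA: "G \<subseteq> A" "a \<in> G" and not: "G - {a} \<notin> semistable_arc_sets t h V (A - {a}) \<theta>"
    using G by (auto simp: essential_def semistable_arc_sets_def)
  have ends': "t b \<in> V \<and> h b \<in> V" if "b \<in> G" for b using that GA ends by blast
  have le0: "sum \<theta> L \<le> 0"
    if "L \<subseteq> V" "successor_closed t h (G - {a}) L" "t a \<in> L \<Longrightarrow> h a \<in> L" for L
  proof -
    have "successor_closed t h G L" using that(2,3) by (auto simp: successor_closed_def)
    then show ?thesis using sst that(1) by (simp add: weight_semistable_def)
  qed
  define \<L> where "\<L> = {J. J \<subseteq> V \<and> successor_closed t h (G - {a}) J \<and> t a \<in> J \<and> h a \<notin> J}"
  have fin: "finite \<L>" using finV by (simp add: \<L>_def)
  obtain J0 where J0: "J0 \<in> \<L>" "sum \<theta> J0 \<ge> 0" using essential_cut[OF G] by (auto simp: \<L>_def)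
  define l where "l = Max (sum \<theta> ` \<L>)"
  have l_max: "sum \<theta> J \<le> l" if "J \<in> \<L>" for J using fin that by (simp add: l_def)
  have "l \<in> sum \<theta> ` \<L>" unfolding l_def using fin J0 by (intro Max_in) auto
  then obtain J1 where "J1 \<in> \<L> \<and> sum \<theta> J1 = l" by blast
  then obtain I where "is_arg_min card (\<lambda>J. J \<in> \<L> \<and> sum \<theta> J = l) I"
    using ex_is_arg_min_if_finite[of "{J \<in> \<L>. sum \<theta> J = l}" card] fin
    by (auto simp: is_arg_min_def)
  then have I: "I \<in> \<L>" "sum \<theta> I = l" and I_min: "\<And>J. J \<in> \<L> \<Longrightarrow> sum \<theta> J = l \<Longrightarrow> card I \<le> card J"
    by (auto simp: is_arg_min_def not_less)
  have I_sub: "I \<subseteq> V" "t a \<in> I" "h a \<notin> I" and I_closed: "\<And>b. b \<in> G \<Longrightarrow> b \<noteq> a \<Longrightarrow> t b \<in> I \<Longrightarrow> h b \<in> I"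
    using I(1) by (auto simp: \<L>_def successor_closed_def)
  have finI: "finite I" using I_sub finV finite_subset by blast
  have l0: "l \<ge> 0" using l_max[OF J0(1)] J0(2) by simp
  define \<K> where "\<K> = {K. K \<subseteq> V - I \<and> h a \<in> K \<and>
    (\<forall>b\<in>G. t b \<in> V - I \<longrightarrow> h b \<in> V - I \<longrightarrow> (t b \<in> K \<longleftrightarrow> h b \<in> K))}"
  have "V - I \<in> \<K>" using I_sub ends'[OF GA(2)] by (auto simp: \<K>_def)
  moreover have finK: "finite \<K>"
    using finV by (intro finite_subset[of \<K> "Pow V"]) (auto simp: \<K>_def)
  ultimately obtain K where "is_arg_min card (\<lambda>K. K \<in> \<K>) K"
    using ex_is_arg_min_if_finite[of \<K> card] by auto
  then have K: "K \<in> \<K>" and K_min: "\<And>K'. K' \<in> \<K> \<Longrightarrow> card K \<le> card K'"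
    by (auto simp: is_arg_min_def not_less)
  have K_sub: "K \<subseteq> V" "I \<inter> K = {}" "h a \<in> K"
    and K_comp: "\<And>b. b \<in> G \<Longrightarrow> t b \<in> V - I \<Longrightarrow> h b \<in> V - I \<Longrightarrow> t b \<in> K \<longleftrightarrow> h b \<in> K"
    using K by (auto simp: \<K>_def)
  have finKs: "finite K" using K_sub finV finite_subset by blast
  let ?R = "V - I - K"

  have arcs: "G \<subseteq> insert a (inner_arcs I \<union> inner_arcs K \<union> rest_arcs I K \<union> cross_arcs I K)"
  proof
    fix b assume b: "b \<in> G"
    show "b \<in> insert a (inner_arcs I \<union> inner_arcs K \<union> rest_arcs I K \<union> cross_arcs I K)"
      using b GA(1) ends'[OF b] I_closed[OF b] K_comp[OF b] K_sub
      unfolding inner_arcs_def rest_arcs_def cross_arcs_def by blast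
  qed

  have in_L: "I \<union> M \<in> \<L>" if "M \<subseteq> V" "h a \<notin> M"
    "\<And>b. b \<in> G \<Longrightarrow> b \<noteq> a \<Longrightarrow> t b \<in> M \<Longrightarrow> h b \<in> I \<union> M" for M
    using that I_sub I_closed by (auto simp: \<L>_def successor_closed_def)
  have in_L_le: "sum \<theta> M \<le> 0" if "M \<subseteq> V" "I \<inter> M = {}" "h a \<notin> M"
    "\<And>b. b \<in> G \<Longrightarrow> b \<noteq> a \<Longrightarrow> t b \<in> M \<Longrightarrow> h b \<in> I \<union> M" for M
    using l_max[OF in_L[OF that(1,3,4)]] sum_Un[OF I_sub(1) that(1,2)] I(2) by simp

  have source_weight: "if t a \<in> J then sum \<theta> J < l \<or> J = I else sum \<theta> J \<le> 0"
    if J: "J \<subseteq> I" "successor_closed t h (G \<inter> inner_arcs I) J" for J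
  proof -
    have closed: "successor_closed t h (G - {a}) J"
      using J I_closed GA(1) by (force simp: successor_closed_def inner_arcs_def)
    show ?thesis
    proof (cases "t a \<in> J")
      case True
      then have "J \<in> \<L>" using J(1) I_sub closed by (auto simp: \<L>_def)
      moreover have "J = I" if "sum \<theta> J = l"
        using I_min[OF \<open>J \<in> \<L>\<close> that] J(1) finI by (simp add: card_seteq)
      ultimately show ?thesis using l_max[of J] True by force
    next
      case False
      then show ?thesis using le0[of J] J(1) I_sub closed by auto
    qed
  qed
  \<comment> \<open>If \<open>I\<close> were cut into two parts, the part with \<open>t a\<close> would weigh less than \<open>I\<close> and the other one at
      most \<open>0\<close>, although the weights sum to that of \<open>I\<close>.\<close>
  have source_con: "cut_connected t h I (G \<inter> inner_arcs I)"
  proof (rule cut_connectedI)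
    show "I \<noteq> {}" using I_sub by auto
    fix J assume J: "J \<subseteq> I" "J \<noteq> {}" "J \<noteq> I"
      "\<And>b. b \<in> G \<inter> inner_arcs I \<Longrightarrow> t b \<in> J \<longleftrightarrow> h b \<in> J"
    have "successor_closed t h (G \<inter> inner_arcs I) J" "successor_closed t h (G \<inter> inner_arcs I) (I - J)"
      using J(4) by (auto simp: successor_closed_def inner_arcs_def)
    note w = source_weight[OF J(1) this(1)] source_weight[OF Diff_subset this(2)]
    have "sum \<theta> I = sum \<theta> (I - J) + sum \<theta> J" by (rule sum.subset_diff[OF J(1) finI])
    moreover have "I - J \<noteq> I" using J by blast
    ultimately show False using w J(3) I(2) I_sub(2) by (auto split: if_splits)
  qed
  have source: "G \<inter> inner_arcs I \<in> source_pieces I"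
    using source_con source_weight strict_weight(2)[OF I_sub(1,2)] I(2)
    by (simp add: source_pieces_def semistable_arc_sets_def weight_semistable_def)

  have target_weight: "sum \<theta> M + (if h a \<in> M then l else 0) \<le> 0"
    if M: "M \<subseteq> K" "successor_closed t h (G \<inter> inner_arcs K) M" for M
  proof -
    have step: "h b \<in> I \<union> M" if "b \<in> G" "b \<noteq> a" "t b \<in> M" for b
    proof (cases "h b \<in> I")
      case False
      then have "b \<in> G \<inter> inner_arcs K"
        using that M(1) K_comp[OF that(1)] K_sub ends'[OF that(1)] GA(1) by (auto simp: inner_arcs_def)
      then show ?thesis using M(2) that(3) by (auto simp: successor_closed_def)
    qed simp
    show ?thesis
    proof (cases "h a \<in> M")
      case False
      then show ?thesis using in_L_le[OF _ _ False step] M(1) K_sub by auto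
    next
      case True
      have "successor_closed t h (G - {a}) (I \<union> M)"
        using step I_closed by (auto simp: successor_closed_def)
      then have "sum \<theta> (I \<union> M) \<le> 0" using True M(1) I_sub K_sub by (intro le0) auto
      also have "sum \<theta> (I \<union> M) = l + sum \<theta> M"
        using sum_Un[of I M] I_sub K_sub M(1) I(2) by auto
      finally show ?thesis using True by simp
    qed
  qed
  have target_con: "cut_connected t h K (G \<inter> inner_arcs K)"
  proof (rule cut_connectedI)
    show "K \<noteq> {}" using K_sub by auto
    fix M assume M: "M \<subseteq> K" "M \<noteq> {}" "M \<noteq> K"
      "\<And>b. b \<in> G \<inter> inner_arcs K \<Longrightarrow> t b \<in> M \<longleftrightarrow> h b \<in> M"
    define M' where "M' = (if h a \<in> M then M else K - M)"
    have M': "M' \<subset> K" "h a \<in> M'" using M K_sub by (auto simp: M'_def)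
    have "t b \<in> M' \<longleftrightarrow> h b \<in> M'" if b: "b \<in> G" "t b \<in> V - I" "h b \<in> V - I" for b
    proof (cases "t b \<in> K")
      case True
      then have "b \<in> G \<inter> inner_arcs K" using K_comp[OF b] b GA(1) by (auto simp: inner_arcs_def)
      then show ?thesis using M(4) by (auto simp: M'_def inner_arcs_def)
    next
      case False
      then show ?thesis using K_comp[OF b] M' by blast
    qed
    then have "M' \<in> \<K>" using M' K_sub by (auto simp: \<K>_def)
    then show False using K_min M' psubset_card_mono[OF finKs M'(1)] by force
  qed
  have target: "G \<inter> inner_arcs K \<in> target_pieces I K"
    unfolding target_pieces_def semistable_arc_sets_def weight_semistable_def
    using target_con target_weight sum_target_weight[OF subset_trans[OF _ K_sub(1)]] I(2)
    by (simp del: fun_upd_apply)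

  \<comment> \<open>The bound for \<open>K\<close> is sharp because the complement of \<open>K\<close> is a candidate too.\<close>
  have "sum \<theta> K \<le> - l"
    using target_weight[of K] K_sub by (simp add: successor_closed_def inner_arcs_def)
  moreover have "V - K \<in> \<L>"
    using K_sub I_sub I_closed K_comp ends' by (fastforce simp: \<L>_def successor_closed_def)
  then have "sum \<theta> (V - K) \<le> l" by (rule l_max)
  moreover have "sum \<theta> V = sum \<theta> (V - K) + sum \<theta> K" by (rule sum.subset_diff[OF K_sub(1) finV])
  ultimately have sumK: "sum \<theta> K = - l" using total by simp

  have rest_sst: "weight_semistable t (collapsed_head I) (insert (t a) ?R) (\<theta>(t a := 0)) (G \<inter> rest_arcs I K)"
    unfolding weight_semistable_def
  proof (intro allI impI)
    fix M assume M: "M \<subseteq> insert (t a) ?R" "successor_closed t (collapsed_head I) (G \<inter> rest_arcs I K) M"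
    define M' where "M' = M - {t a}"
    have M': "M' \<subseteq> ?R" "t a \<notin> M'" using M(1) by (auto simp: M'_def)
    have "sum \<theta> M' \<le> 0"
    proof (rule in_L_le)
      fix b assume b: "b \<in> G" "b \<noteq> a" "t b \<in> M'"
      then have "b \<in> G \<inter> rest_arcs I K"
        using M' K_comp[OF b(1)] ends'[OF b(1)] GA(1) K_sub by (auto simp: rest_arcs_def)
      then have "collapsed_head I b \<in> M" using M(2) b(3) by (auto simp: successor_closed_def M'_def)
      then show "h b \<in> I \<union> M'" using I_sub by (auto simp: collapsed_head_def M'_def split: if_splits)
    qed (use M' K_sub in auto)
    moreover have "sum (\<theta>(t a := 0)) M = sum \<theta> M'"
      using sum_rest_weight[of M'] M' M'_def by (cases "t a \<in> M") (auto simp: insert_absorb)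
    ultimately show "sum (\<theta>(t a := 0)) M \<le> 0" by simp
  qed
  have rest_con: "cut_connected t (collapsed_head I) (insert (t a) ?R) (G \<inter> rest_arcs I K)"
  proof (rule cut_connectedI)
    fix M assume M: "M \<subseteq> insert (t a) ?R" "M \<noteq> {}" "M \<noteq> insert (t a) ?R"
      "\<And>b. b \<in> G \<inter> rest_arcs I K \<Longrightarrow> t b \<in> M \<longleftrightarrow> collapsed_head I b \<in> M"
    define M' where "M' = (if t a \<in> M then ?R - M else M)"
    have M': "M' \<subseteq> ?R" "M' \<noteq> {}" "t a \<notin> M'" using M(1-3) I_sub by (auto simp: M'_def)
    have rest: "t b \<in> M' \<longleftrightarrow> h b \<in> M'" if "b \<in> G \<inter> rest_arcs I K" for b
    proof -
      have "t b \<in> ?R" "h b \<in> I \<union> ?R" using that by (auto simp: rest_arcs_def)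
      then show ?thesis using M(1) M(4)[OF that] I_sub
        by (auto simp: M'_def collapsed_head_def split: if_splits)
    qed
    have "t b \<in> M' \<longleftrightarrow> h b \<in> M'" if b: "b \<in> G" for b
    proof (cases "b \<in> rest_arcs I K")
      case False
      then have "t b \<notin> ?R" "h b \<notin> ?R"
        using b arcs K_sub I_sub by (auto simp: inner_arcs_def cross_arcs_def rest_arcs_def)
      then show ?thesis using M' by blast
    qed (use rest b in blast)
    then have "M' = {} \<or> M' = V" using M' by (intro cut_connectedD[OF con]) auto
    then show False using M' I_sub by blast
  qed auto
  have rest: "G \<inter> rest_arcs I K \<in> rest_pieces I K"
    using rest_sst rest_con by (simp add: rest_pieces_def semistable_arc_sets_def)

  \<comment> \<open>An arrow from \<open>K\<close> to \<open>I\<close> takes over the role of \<open>a\<close> for connectedness, and for \<open>l = 0\<close> also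
      semistability survives without \<open>a\<close>.\<close>
  have "G \<inter> cross_arcs I K = {}" if "l = 0"
  proof (rule ccontr)
    assume "G \<inter> cross_arcs I K \<noteq> {}"
    then obtain b where b: "b \<in> G" "t b \<in> K" "h b \<in> I" by (auto simp: cross_arcs_def)
    have notin: "a \<notin> inner_arcs I" "a \<notin> inner_arcs K" "a \<notin> rest_arcs I K"
      using I_sub K_sub by (auto simp: inner_arcs_def rest_arcs_def)
    have "(G - {a}) \<inter> inner_arcs I = G \<inter> inner_arcs I" "(G - {a}) \<inter> inner_arcs K = G \<inter> inner_arcs K"
      "(G - {a}) \<inter> rest_arcs I K = G \<inter> rest_arcs I K"
      using notin by auto
    moreover have "b \<in> G - {a}" using b K_sub I_sub by auto
    ultimately have "cut_connected t h V (G - {a})"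
      using source_con target_con rest_con b I_sub K_sub
      by (intro glued_connected[of I K "G - {a}" b]) auto
    moreover have "weight_semistable t h V \<theta> (G - {a})"
      unfolding weight_semistable_def
    proof (intro allI impI)
      fix L assume L: "L \<subseteq> V" "successor_closed t h (G - {a}) L"
      show "sum \<theta> L \<le> 0"
      proof (cases "t a \<in> L \<and> h a \<notin> L")
        case True
        then have "L \<in> \<L>" using L by (simp add: \<L>_def)
        then show ?thesis using l_max that by fastforce
      qed (use le0[OF L] in blast)
    qed
    ultimately show False using not GA(1) by (auto simp: semistable_arc_sets_def)
  qed
  then have "G \<inter> cross_arcs I K \<in> cross_pieces I K" using I(2) by (simp add: cross_pieces_def)
  moreover have "(I, K) \<in> splittings"
    using I_sub K_sub l0 sumK I(2) by (simp add: splittings_def)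
  ultimately show ?thesis unfolding splits_def using GA arcs source target rest by blast
qed

lemma arcs_disjoint:
  assumes "(I, K) \<in> splittings"
  shows "a \<notin> inner_arcs I" "a \<notin> inner_arcs K" "a \<notin> rest_arcs I K" "a \<notin> cross_arcs I K"
    "inner_arcs I \<inter> inner_arcs K = {}" "inner_arcs I \<inter> rest_arcs I K = {}"
    "inner_arcs I \<inter> cross_arcs I K = {}" "inner_arcs K \<inter> rest_arcs I K = {}"
    "inner_arcs K \<inter> cross_arcs I K = {}" "rest_arcs I K \<inter> cross_arcs I K = {}"
proof -
  have "I \<inter> K = {}" "t a \<in> I" "h a \<in> K" using assms by (auto simp: splittings_def)
  then show "a \<notin> inner_arcs I" "a \<notin> inner_arcs K" "a \<notin> rest_arcs I K" "a \<notin> cross_arcs I K"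
    "inner_arcs I \<inter> inner_arcs K = {}" "inner_arcs I \<inter> rest_arcs I K = {}"
    "inner_arcs I \<inter> cross_arcs I K = {}" "inner_arcs K \<inter> rest_arcs I K = {}"
    "inner_arcs K \<inter> cross_arcs I K = {}" "rest_arcs I K \<inter> cross_arcs I K = {}"
    unfolding inner_arcs_def rest_arcs_def cross_arcs_def by blast+
qed

lemma splitting_finite:
  assumes "(I, K) \<in> splittings"
  shows "finite I" "finite K" "finite (V - I - K)"
  using assms finV by (auto simp: splittings_def intro: finite_subset[OF _ finV])

lemma card_pieces:
  assumes "(I, K) \<in> splittings"
  shows "G \<in> source_pieces I \<Longrightarrow> finite G \<and> card I \<le> card G + 1"
    "G \<in> target_pieces I K \<Longrightarrow> finite G \<and> card K \<le> card G + 1"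
    "G \<in> rest_pieces I K \<Longrightarrow> finite G \<and> card (insert (t a) (V - I - K)) \<le> card G + 1"
proof -
  note fin = splitting_finite[OF assms]
  have finA': "finite (inner_arcs I)" "finite (inner_arcs K)" "finite (rest_arcs I K)"
    using finA by (simp_all add: inner_arcs_def rest_arcs_def)
  show "finite G \<and> card I \<le> card G + 1" if "G \<in> source_pieces I"
    using semistable_arc_sets_card[OF fin(1) finA'(1) _ that[unfolded source_pieces_def]]
    by (simp add: inner_arcs_def)
  show "finite G \<and> card K \<le> card G + 1" if "G \<in> target_pieces I K"
    using semistable_arc_sets_card[OF fin(2) finA'(2) _ that[unfolded target_pieces_def]]
    by (simp add: inner_arcs_def)
  have fin3: "finite (insert (t a) (V - I - K))" using fin(3) by simp
  show "finite G \<and> card (insert (t a) (V - I - K)) \<le> card G + 1" if "G \<in> rest_pieces I K"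
    using semistable_arc_sets_card[OF fin3 finA'(3) _ that[unfolded rest_pieces_def]]
    by (simp add: rest_arcs_def collapsed_head_def)
qed

definition weight :: "'e set \<Rightarrow> int poly" where
  "weight G = [:- 1, 1:] ^ (card G + 1 - card V)"

text \<open>
  The pieces can be chosen independently of each other. Exponents add up: \<open>G\<close> has one arrow, namely \<open>a\<close>,
  in addition to its pieces, and the three vertex sets count \<open>t a\<close> twice, so that the first Betti
  number of \<open>G\<close> is the sum of those of the pieces and the number of arrows from \<open>K\<close> to \<open>I\<close>.
\<close>

lemma sum_splits:
  assumes IK: "(I, K) \<in> splittings"
  shows "(\<Sum>G | splits G I K. weight G) =
    weight_invariant t h I (inner_arcs I) (strict_weight I) *
    weight_invariant t h K (inner_arcs K) (\<theta>(h a := \<theta> (h a) + sum \<theta> I)) *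
    weight_invariant t (collapsed_head I) (insert (t a) (V - I - K)) (rest_arcs I K) (\<theta>(t a := 0)) *
    (\<Sum>S\<in>cross_pieces I K. [:- 1, 1:] ^ card S)"
proof -
  let ?R = "V - I - K"
  let ?P = "source_pieces I \<times> target_pieces I K \<times> rest_pieces I K \<times> cross_pieces I K"
  let ?x = "[:- 1, 1 :: int:]"
  let ?join = "\<lambda>(G1, G2, G3, S). insert a (G1 \<union> G2 \<union> G3 \<union> S)"
  let ?parts = "\<lambda>G. (G \<inter> inner_arcs I, G \<inter> inner_arcs K, G \<inter> rest_arcs I K, G \<inter> cross_arcs I K)"
  let ?w3 = "\<lambda>(G3, S). ?x ^ (card G3 - card ?R) * ?x ^ card (S :: 'e set)"
  let ?w2 = "\<lambda>(G2, p). ?x ^ (card G2 + 1 - card K) * ?w3 p"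
  let ?w = "\<lambda>(G1, p). ?x ^ (card G1 + 1 - card I) * ?w2 p"
  note dis = arcs_disjoint[OF IK] and fin = splitting_finite[OF IK]
  have tR: "card (insert (t a) ?R) = Suc (card ?R)"
    using IK fin by (simp add: splittings_def)
  have cardV: "card V = card I + card K + card ?R"
  proof -
    have "card (I \<union> K) = card I + card K"
      using IK fin by (intro card_Un_disjoint) (auto simp: splittings_def)
    moreover have "card ((I \<union> K) \<union> ?R) = card (I \<union> K) + card ?R"
      using fin by (intro card_Un_disjoint) auto
    moreover have "(I \<union> K) \<union> ?R = V" using IK by (auto simp: splittings_def)
    ultimately show ?thesis by simp
  qed
  have piece_sub: "G1 \<subseteq> inner_arcs I" "G2 \<subseteq> inner_arcs K" "G3 \<subseteq> rest_arcs I K" "S \<subseteq> cross_arcs I K"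
    if "(G1, G2, G3, S) \<in> ?P" for G1 G2 G3 S
    using that by (auto simp: source_pieces_def target_pieces_def rest_pieces_def cross_pieces_def
        semistable_arc_sets_def split: if_splits)
  have parts_join: "?parts (?join p) = p" if "p \<in> ?P" for p
  proof -
    obtain G1 G2 G3 S where p: "p = (G1, G2, G3, S)" by (cases p)
    then show ?thesis using piece_sub[of G1 G2 G3 S] that dis unfolding p by simp blast
  qed
  have "(\<Sum>G | splits G I K. weight G) = sum ?w ?P"
  proof (rule sum.reindex_bij_witness[where i = ?join and j = ?parts])
    fix G assume "G \<in> {G. splits G I K}"
    then have G: "a \<in> G" "G \<subseteq> insert a (inner_arcs I \<union> inner_arcs K \<union> rest_arcs I K \<union> cross_arcs I K)"
      and P: "?parts G \<in> ?P"
      by (auto simp: splits_def)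
    show "?parts G \<in> ?P" by (rule P)
    show join: "?join (?parts G) = G" using G by auto
    define G1 G2 G3 S where "G1 = G \<inter> inner_arcs I" "G2 = G \<inter> inner_arcs K"
      "G3 = G \<inter> rest_arcs I K" "S = G \<inter> cross_arcs I K"
    note defs = this
    have "finite S" using finA by (auto simp: defs cross_arcs_def)
    moreover have c: "finite G1 \<and> card I \<le> card G1 + 1" "finite G2 \<and> card K \<le> card G2 + 1"
      "finite G3 \<and> card ?R \<le> card G3"
      using P card_pieces[OF IK] tR by (auto simp: defs)
    moreover have "G1 \<inter> G2 = {}" "(G1 \<union> G2) \<inter> G3 = {}" "(G1 \<union> G2 \<union> G3) \<inter> S = {}"
      "a \<notin> G1 \<union> G2 \<union> G3 \<union> S"
      using dis by (auto simp: defs)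
    ultimately have "card (insert a (G1 \<union> G2 \<union> G3 \<union> S)) = card G1 + card G2 + card G3 + card S + 1"
      by (simp add: card_Un_disjoint)
    then have "card G = card G1 + card G2 + card G3 + card S + 1"
      using join by (simp add: defs)
    then have "card G + 1 - card V = (card G1 + 1 - card I) + ((card G2 + 1 - card K) + ((card G3 - card ?R) + card S))"
      using c cardV by simp
    then show "?w (?parts G) = weight G"
      by (simp only: weight_def power_add defs prod.case)
  next
    fix p assume p: "p \<in> ?P"
    show "?parts (?join p) = p" by (rule parts_join[OF p])
    obtain G1 G2 G3 S where p_eq: "p = (G1, G2, G3, S)" by (cases p)
    define G where "G = insert a (G1 \<union> G2 \<union> G3 \<union> S)"
    have "?parts G = p" using parts_join[OF p] by (simp only: p_eq G_def prod.case)
    then have "?parts G \<in> ?P" using p by (simp only:)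
    moreover have "G \<subseteq> insert a (inner_arcs I \<union> inner_arcs K \<union> rest_arcs I K \<union> cross_arcs I K)"
      using piece_sub[of G1 G2 G3 S] p unfolding G_def p_eq by blast
    moreover have "a \<in> G" by (simp add: G_def)
    ultimately have "splits G I K" using IK unfolding splits_def by (simp only: mem_Times_iff fst_conv snd_conv simp_thms)
    then show "?join p \<in> {G. splits G I K}" by (simp only: p_eq G_def prod.case mem_Collect_eq)
  qed
  also have "\<dots> = (\<Sum>G\<in>source_pieces I. ?x ^ (card G + 1 - card I)) *
      ((\<Sum>G\<in>target_pieces I K. ?x ^ (card G + 1 - card K)) *
      ((\<Sum>G\<in>rest_pieces I K. ?x ^ (card G - card ?R)) * (\<Sum>S\<in>cross_pieces I K. ?x ^ card S)))"
    by (simp only: sum_times)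
  finally show ?thesis
    by (simp add: weight_invariant_def source_pieces_def target_pieces_def rest_pieces_def tR mult.assoc)
qed

text \<open>
  The arc sets which avoid \<open>a\<close> correspond to those from which \<open>a\<close> can be removed, and their terms differ
  by the factor \<open>q - 1\<close>; together they make up the first summand.
\<close>

lemma deletion_recursion:
  "weight_invariant t h V A \<theta> = [:0, 1:] * weight_invariant t h V (A - {a}) \<theta> +
    (\<Sum>(I, K)\<in>splittings. \<Sum>G | splits G I K. weight G)"
proof -
  let ?C = "semistable_arc_sets t h V (A - {a}) \<theta>"
  let ?D = "semistable_arc_sets t h V A \<theta>"
  let ?x = "[:- 1, 1 :: int:]"
  have sum_weight: "weight_invariant t h V B \<theta> = sum weight (semistable_arc_sets t h V B \<theta>)" for B
    unfolding weight_invariant_def weight_def ..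
  have finC: "finite ?C" using finA by (simp add: semistable_arc_sets_finite)
  have finE: "finite essential"
    using finA by (auto simp: essential_def semistable_arc_sets_finite)
  have up: "insert a G \<in> ?D" "G \<in> ?D" if "G \<in> ?C" for G
    using that a unfolding semistable_arc_sets_def cut_connected_def weight_semistable_def
      successor_closed_def by auto
  have a_notin: "a \<notin> G" if "G \<in> ?C" for G using that by (auto simp: semistable_arc_sets_def)
  have C_iff: "G \<in> ?C \<longleftrightarrow> G \<in> ?D \<and> a \<notin> G" for G by (auto simp: semistable_arc_sets_def)
  have "?D = (?C \<union> insert a ` ?C) \<union> essential"
  proof (intro equalityI subsetI)
    fix G assume G: "G \<in> ?D"
    show "G \<in> (?C \<union> insert a ` ?C) \<union> essential"
    proof (cases "a \<in> G \<and> G - {a} \<in> ?C")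
      case True
      then have "insert a (G - {a}) \<in> insert a ` ?C" by blast
      moreover have "insert a (G - {a}) = G" using True by auto
      ultimately show ?thesis by simp
    next
      case False
      then show ?thesis using G C_iff by (simp add: essential_def)
    qed
  next
    fix G assume "G \<in> (?C \<union> insert a ` ?C) \<union> essential"
    then show "G \<in> ?D" using up unfolding essential_def by blast
  qed
  then have "weight_invariant t h V A \<theta> = sum weight ((?C \<union> insert a ` ?C) \<union> essential)"
    by (simp only: sum_weight)
  also have "\<dots> = sum weight (?C \<union> insert a ` ?C) + sum weight essential"
  proof (rule sum.union_disjoint)
    show "(?C \<union> insert a ` ?C) \<inter> essential = {}" using a_notin by (auto simp: essential_def)
  qed (use finC finE in auto)
  also have "sum weight (?C \<union> insert a ` ?C) = sum weight ?C + sum weight (insert a ` ?C)"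
    using finC a_notin by (intro sum.union_disjoint) auto
  also have "sum weight (insert a ` ?C) = (\<Sum>G\<in>?C. ?x * weight G)"
  proof (rule sum.reindex_cong)
    show "inj_on (insert a) ?C"
      by (rule inj_onI) (metis a_notin insert_ident)
    fix G assume G: "G \<in> ?C"
    have "finite G" "card V \<le> card G + 1"
      using semistable_arc_sets_card[OF finV _ _ G] finA ends by auto
    then show "weight (insert a G) = ?x * weight G"
      using a_notin[OF G] by (simp add: weight_def Suc_diff_le)
  qed simp
  also have "sum weight ?C + (\<Sum>G\<in>?C. ?x * weight G) = (1 + ?x) * sum weight ?C"
    by (simp only: sum_distrib_left[symmetric] distrib_right mult_1_left)
  also have "1 + ?x = [:0, 1:]" by (simp add: one_pCons)
  also have "sum weight ?C = weight_invariant t h V (A - {a}) \<theta>"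
    by (simp only: sum_weight)
  also have "sum weight essential = (\<Sum>p\<in>splittings. \<Sum>G | splits G (fst p) (snd p). weight G)"
  proof -
    have "essential = (\<Union>p\<in>splittings. {G. splits G (fst p) (snd p)})"
    proof (intro equalityI subsetI)
      fix G assume "G \<in> essential"
      then obtain I K where "splits G I K" using essential_splits by blast
      moreover from this have "(I, K) \<in> splittings" by (simp add: splits_def)
      ultimately show "G \<in> (\<Union>p\<in>splittings. {G. splits G (fst p) (snd p)})" by force
    qed (use split_essential in blast)
    moreover have "finite splittings"
      using finV by (intro finite_subset[of splittings "Pow V \<times> Pow V"]) (auto simp: splittings_def)
    moreover have "finite {G. splits G (fst p) (snd p)}" for p
      by (rule finite_subset[OF _ finE]) (use split_essential in auto)
    moreover have "{G. splits G (fst p) (snd p)} \<inter> {G. splits G (fst p') (snd p')} = {}"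
      if "p \<noteq> p'" for p p'
      using split_unique that by (fastforce simp: prod_eq_iff)
    ultimately show ?thesis by (simp add: sum.UNION_disjoint)
  qed
  finally show ?thesis by (simp only: split_def)
qed

end

section \<open>Positivity for an arbitrary weight\<close>

text \<open>
  The arrow \<open>a\<close> belongs to none of the quivers on the right-hand side of the recursion, so induction on
  the set of arrows works although weights, heads and vertex sets change.
\<close>

theorem weight_invariant_nonneg:
  fixes \<theta> :: "'v \<Rightarrow> real"
  assumes "finite A" "finite V" "\<And>b. b \<in> A \<Longrightarrow> t b \<in> V \<and> h b \<in> V" "sum \<theta> V = 0"
  shows "nonneg_coeffs (weight_invariant t h V A \<theta>)"
  using assms
proof (induction A arbitrary: h V \<theta> rule: finite_psubset_induct)
  case (psubset A)
  show ?case
  proof (cases "A = {}")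
    case True
    have "card G + 1 - card V = 0" if "G \<in> semistable_arc_sets t h V A \<theta>" for G
    proof -
      have "V \<noteq> {}" "G = {}" using that True by (auto simp: semistable_arc_sets_def cut_connected_def)
      then show ?thesis using psubset.prems(1) card_gt_0_iff[of V] by simp
    qed
    then show ?thesis
      unfolding weight_invariant_def by (intro nonneg_coeffs_sum) (simp add: nonneg_coeffs_1)
  next
    case False
    then obtain a where a: "a \<in> A" by blast
    interpret arrow_deletion t h V A \<theta> a
      using psubset.hyps psubset.prems a by unfold_locales auto
    have "nonneg_coeffs (\<Sum>G | splits G I K. weight G)" if IK: "(I, K) \<in> splittings" for I K
    proof -
      note fin = splitting_finite[OF IK]
      have s: "I \<subseteq> V" "K \<subseteq> V" "I \<inter> K = {}" "t a \<in> I" "h a \<in> K" "sum \<theta> K = - sum \<theta> I"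
        using IK by (auto simp: splittings_def)
      have sub: "inner_arcs I \<subset> A" "inner_arcs K \<subset> A" "rest_arcs I K \<subset> A"
        using arcs_disjoint(1-3)[OF IK] a by (auto simp: inner_arcs_def rest_arcs_def)
      have "nonneg_coeffs (weight_invariant t h I (inner_arcs I) (strict_weight I))"
        using fin strict_weight(1)[OF s(1,4)] by (intro psubset.IH sub) (auto simp: inner_arcs_def)
      moreover have "nonneg_coeffs (weight_invariant t h K (inner_arcs K)
          (\<theta>(h a := \<theta> (h a) + sum \<theta> I)))"
        using fin s sum_target_weight[OF s(2), of "sum \<theta> I"]
        by (intro psubset.IH sub) (auto simp: inner_arcs_def)
      moreover have "nonneg_coeffs (weight_invariant t (collapsed_head I)
          (insert (t a) (V - I - K)) (rest_arcs I K) (\<theta>(t a := 0)))"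
      proof (rule psubset.IH[OF sub(3)])
        have "sum \<theta> V = sum \<theta> (V - (I \<union> K)) + sum \<theta> (I \<union> K)"
          using s finV by (intro sum.subset_diff) auto
        moreover have "sum \<theta> (I \<union> K) = 0" using sum_Un[OF s(1-3)] s(6) by simp
        moreover have "V - (I \<union> K) = V - I - K" by blast
        ultimately have "sum \<theta> (V - I - K) = 0" using total by simp
        then show "sum (\<theta>(t a := 0)) (insert (t a) (V - I - K)) = 0"
          using sum_rest_weight(2)[of "V - I - K"] s(4) by auto
      qed (use fin in \<open>auto simp: rest_arcs_def collapsed_head_def\<close>)
      moreover have "nonneg_coeffs (\<Sum>S\<in>cross_pieces I K. [:- 1, 1:] ^ card S)"
        using finA by (simp add: cross_pieces_def sum_Pow_shifted_power cross_arcs_def nonneg_coeffs_1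
            nonneg_coeffs_power nonneg_coeffs_X)
      ultimately show ?thesis by (simp only: sum_splits[OF IK] nonneg_coeffs_mult)
    qed
    then have "nonneg_coeffs (\<Sum>(I, K)\<in>splittings. \<Sum>G | splits G I K. weight G)"
      by (auto intro: nonneg_coeffs_sum simp: split_def)
    moreover have "nonneg_coeffs (weight_invariant t h V (A - {a}) \<theta>)"
      using a psubset.prems by (intro psubset.IH) auto
    ultimately show ?thesis
      by (simp only: deletion_recursion nonneg_coeffs_add nonneg_coeffs_mult nonneg_coeffs_X)
  qed
qed

section \<open>Classes of strata in the Grothendieck ring\<close>

lemma K0_eqI: "a - b \<in> scissor_ideal \<Longrightarrow> abs_K0 a = abs_K0 b"
  by (simp add: K0.abs_eq_iff)

lemma motivic_class_iso:
  assumes "quasi_affine X" "quasi_affine Y" "isomorphic_varieties X Y"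
  shows "motivic_class X = motivic_class Y"
  unfolding motivic_class_def
  using assms by (intro K0_eqI scissor_ideal.iso) (simp add: Variety_inverse)

lemma motivic_class_scissor:
  assumes "quasi_affine X" "quasi_affine Y" "quasi_affine (X - Y)" "closed_subvariety Y X"
  shows "motivic_class X = motivic_class Y + motivic_class (X - Y)"
  unfolding motivic_class_def plus_K0.abs_eq
  using assms by (intro K0_eqI scissor_ideal.scissor) (simp_all add: Variety_inverse)

lemma motivic_class_product:
  assumes "quasi_affine X" "quasi_affine Y"
  shows "motivic_class (product_variety X Y) = motivic_class X * motivic_class Y"
proof -
  have "Variety (product_variety X Y) = Variety X + Variety Y"
    using assms by (simp add: plus_variety_def Variety_inverse)
  then show ?thesis by (simp add: motivic_class_def times_K0.abs_eq mult_single)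
qed

lemma motivic_class_point: "motivic_class {[]} = 1"
proof -
  have "Variety {[]} = 0" by (simp add: zero_variety_def)
  then show ?thesis by (simp add: motivic_class_def one_K0_def)
qed

text \<open>
  With the ambient space fixed, the varieties can be cut by the coordinate hyperplanes of that space.
\<close>

definition quasi_affine_in :: "nat \<Rightarrow> complex list set \<Rightarrow> bool" where
  "quasi_affine_in n X \<longleftrightarrow> (\<exists>C D. zariski_closed n C \<and> zariski_closed n D \<and> X = C - D)"

lemma quasi_affine_in_imp: "quasi_affine_in n X \<Longrightarrow> quasi_affine X"
  by (auto simp: quasi_affine_in_def quasi_affine_def)

lemma quasi_affine_in_subset: "quasi_affine_in n X \<Longrightarrow> X \<subseteq> affine_space n"
  using zariski_closed_subset by (fastforce simp: quasi_affine_in_def)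

lemma quasi_affine_imp_in:
  assumes "quasi_affine X" "X \<subseteq> affine_space n"
  shows "quasi_affine_in n X"
proof (cases "X = {}")
  case True
  then show ?thesis
    unfolding quasi_affine_in_def using zariski_closed_affine_space[of n] by blast
next
  case False
  obtain m C D where m: "zariski_closed m C" "zariski_closed m D" "X = C - D"
    using assms(1) unfolding quasi_affine_def by blast
  then have "X \<subseteq> affine_space m" using zariski_closed_subset by blast
  then have "m = n" using False assms(2) by (auto simp: affine_space_def)
  then show ?thesis unfolding quasi_affine_in_def using m by blast
qed

lemma quasi_affine_empty: "quasi_affine {}"
  unfolding quasi_affine_def using zariski_closed_affine_space by blast

lemma motivic_class_empty: "motivic_class {} = 0"
proof -
  have "closed_subvariety {} {}"
    unfolding closed_subvariety_def using zariski_closed_affine_space by blast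
  then show ?thesis using motivic_class_scissor[of "{}" "{}"] quasi_affine_empty by simp
qed

lemma zariski_closed_hyperplane: "i < n \<Longrightarrow> zariski_closed n {xs \<in> affine_space n. xs ! i = 0}"
  unfolding zariski_closed_def
  by (intro exI[of _ "{\<lambda>xs. xs ! i}"]) (auto intro: poly_fun.coord)

lemma split_coordinate:
  assumes X: "quasi_affine_in n X" and i: "i < n"
  shows "quasi_affine_in n {xs \<in> X. xs ! i = 0}" "quasi_affine_in n {xs \<in> X. xs ! i \<noteq> 0}"
    "motivic_class X = motivic_class {xs \<in> X. xs ! i = 0} + motivic_class {xs \<in> X. xs ! i \<noteq> 0}"
proof -
  obtain C D where CD: "zariski_closed n C" "zariski_closed n D" "X = C - D"
    using X unfolding quasi_affine_in_def by blast
  let ?H = "{xs \<in> affine_space n. xs ! i = 0}"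
  have H: "zariski_closed n ?H" using i by (rule zariski_closed_hyperplane)
  have sub: "X \<subseteq> affine_space n" using X by (rule quasi_affine_in_subset)
  have eq: "{xs \<in> X. xs ! i = 0} = C \<inter> ?H - D" "{xs \<in> X. xs ! i \<noteq> 0} = C - (D \<union> ?H)"
    "{xs \<in> X. xs ! i = 0} = X \<inter> ?H" "{xs \<in> X. xs ! i \<noteq> 0} = X - {xs \<in> X. xs ! i = 0}"
    using CD(3) sub by auto
  show q: "quasi_affine_in n {xs \<in> X. xs ! i = 0}" "quasi_affine_in n {xs \<in> X. xs ! i \<noteq> 0}"
    unfolding quasi_affine_in_def eq(1,2)
    using CD H zariski_closed_Int[OF CD(1) H] zariski_closed_Un[OF CD(2) H] by blast+
  have "closed_subvariety {xs \<in> X. xs ! i = 0} X"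
    unfolding closed_subvariety_def eq(3) using sub H by blast
  then show "motivic_class X = motivic_class {xs \<in> X. xs ! i = 0} + motivic_class {xs \<in> X. xs ! i \<noteq> 0}"
    using motivic_class_scissor[OF quasi_affine_in_imp[OF X] quasi_affine_in_imp[OF q(1)]]
      quasi_affine_in_imp[OF q(2)] unfolding eq(4)[symmetric] by blast
qed

text \<open>
  The first \<open>k\<close> coordinates are split one after the other into their zero locus and its complement.
\<close>

lemma motivic_class_strata:
  assumes "quasi_affine_in n X" "k \<le> n"
  shows "motivic_class X =
    (\<Sum>J\<in>Pow {..<k}. motivic_class {xs \<in> X. \<forall>j<k. xs ! j \<noteq> 0 \<longleftrightarrow> j \<in> J})"
  using assms
proof (induction k arbitrary: X)
  case (Suc k)
  let ?Y = "\<lambda>X k J. {xs \<in> X. \<forall>j<k. xs ! j \<noteq> 0 \<longleftrightarrow> j \<in> J}"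
  have k: "k < n" using Suc.prems by simp
  note split = split_coordinate[OF Suc.prems(1) k]
  have le: "k \<le> n" using k by simp
  have eq: "?Y {xs \<in> X. xs ! k = 0} k J = ?Y X (Suc k) J"
    "?Y {xs \<in> X. xs ! k \<noteq> 0} k J = ?Y X (Suc k) (insert k J)" if "J \<in> Pow {..<k}" for J
  proof -
    have "k \<notin> J" using that by auto
    then show "?Y {xs \<in> X. xs ! k = 0} k J = ?Y X (Suc k) J"
      "?Y {xs \<in> X. xs ! k \<noteq> 0} k J = ?Y X (Suc k) (insert k J)"
      by (auto simp: less_Suc_eq)
  qed
  have inj: "inj_on (insert k) (Pow {..<k})"
  proof (rule inj_onI)
    fix J J' assume "J \<in> Pow {..<k}" "J' \<in> Pow {..<k}" "insert k J = insert k J'"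
    moreover from this have "k \<notin> J" "k \<notin> J'" by auto
    ultimately show "J = J'" by (metis insert_ident)
  qed
  have "motivic_class X = (\<Sum>J\<in>Pow {..<k}. motivic_class (?Y X (Suc k) J)) +
      (\<Sum>J\<in>Pow {..<k}. motivic_class (?Y X (Suc k) (insert k J)))"
    unfolding split(3) Suc.IH[OF split(1) le] Suc.IH[OF split(2) le]
    by (intro arg_cong2[of _ _ _ _ "(+)"] sum.cong refl) (simp_all only: eq)
  also have "(\<Sum>J\<in>Pow {..<k}. motivic_class (?Y X (Suc k) (insert k J))) =
      (\<Sum>J\<in>insert k ` Pow {..<k}. motivic_class (?Y X (Suc k) J))"
    by (simp only: sum.reindex[OF inj] o_def)
  also have "(\<Sum>J\<in>Pow {..<k}. motivic_class (?Y X (Suc k) J)) + \<dots> =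
      (\<Sum>J\<in>Pow {..<k} \<union> insert k ` Pow {..<k}. motivic_class (?Y X (Suc k) J))"
    by (rule sum.union_disjoint[symmetric]) auto
  also have "Pow {..<k} \<union> insert k ` Pow {..<k} = Pow {..<Suc k}"
    by (simp only: Pow_insert[symmetric] lessThan_Suc)
  finally show ?case .
qed simp

definition stratum :: "nat \<Rightarrow> nat set \<Rightarrow> complex list set" where
  "stratum n J = {xs \<in> affine_space n. \<forall>j<n. xs ! j \<noteq> 0 \<longleftrightarrow> j \<in> J}"

lemma regular_map_const:
  assumes "X \<subseteq> affine_space n" "ys \<in> Y" "Y \<subseteq> affine_space m"
  shows "regular_map X Y (\<lambda>_. ys)"
proof -
  have "regular_function n X (\<lambda>x. ys ! j)" for j
    unfolding regular_function_def
    by (intro ballI bexI[of _ "\<lambda>_. ys ! j"] bexI[of _ "\<lambda>_. 1"]) (auto intro: poly_fun.const)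
  then have "X \<subseteq> affine_space n \<and> Y \<subseteq> affine_space m \<and> (\<lambda>_. ys) ` X \<subseteq> Y \<and>
      (\<forall>j<m. regular_function n X (\<lambda>x. (\<lambda>_. ys) x ! j))"
    using assms by auto
  then show ?thesis unfolding regular_map_def by (intro exI)
qed

lemma motivic_class_origin: "quasi_affine {[0]}" "motivic_class {[0]} = 1"
  and motivic_class_punctured_line:
    "quasi_affine (affine_space 1 - {[0]})" "motivic_class (affine_space 1 - {[0]}) = lefschetz - 1"
proof -
  have o: "zariski_closed 1 {[0]}"
  proof -
    have "{xs \<in> affine_space 1. xs ! 0 = 0} = {[0 :: complex]}"
      by (auto simp: affine_space_def length_Suc_conv)
    then show ?thesis using zariski_closed_hyperplane[of 0 1] by simp
  qed
  have A: "zariski_closed 1 (affine_space 1)" by (rule zariski_closed_affine_space)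
  show q2: "quasi_affine (affine_space 1 - {[0]})"
    unfolding quasi_affine_def by (intro exI conjI) (rule A, rule o, rule refl)
  have "zariski_closed 1 {}"
    unfolding zariski_closed_def by (intro exI[of _ "{\<lambda>_. 1}"]) (auto intro: poly_fun.const)
  from o this have "quasi_affine ({[0]} - {})"
    unfolding quasi_affine_def by (intro exI conjI) (assumption, assumption, rule refl)
  then show q1: "quasi_affine {[0]}" by simp
  note q = q1 q2
  have "isomorphic_varieties {[0]} {[]}"
  proof -
    have "regular_map {[0]} {[]} (\<lambda>_. [])"
      by (rule regular_map_const[of _ 1 _ _ 0]) (auto simp: affine_space_def)
    moreover have "regular_map {[]} {[0]} (\<lambda>_. [0])"
      by (rule regular_map_const[of _ 0 _ _ 1]) (auto simp: affine_space_def)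
    ultimately show ?thesis unfolding isomorphic_varieties_def by fastforce
  qed
  then show one: "motivic_class {[0]} = 1"
    using motivic_class_iso[OF q(1) quasi_affine_point] motivic_class_point by simp
  have "closed_subvariety {[0]} (affine_space 1)"
  proof -
    have "{[0]} = affine_space 1 \<inter> {[0]}" using zariski_closed_subset[OF o] by blast
    with o show ?thesis unfolding closed_subvariety_def by blast
  qed
  then have "lefschetz = 1 + motivic_class (affine_space 1 - {[0]})"
    unfolding lefschetz_def one[symmetric]
    using motivic_class_scissor[OF quasi_affine_affine_space q] by blast
  then show "motivic_class (affine_space 1 - {[0]}) = lefschetz - 1" by (simp add: algebra_simps)
qed

text \<open>
  The last coordinate of a point of a stratum is independent of the others, so every stratum is a
  product of points and punctured lines.
\<close>

lemma stratum_Suc: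
  "stratum (Suc n) J = product_variety (stratum n J) (if n \<in> J then affine_space 1 - {[0]} else {[0]})"
    (is "_ = product_variety _ ?Y")
proof -
  have Y: "ys \<in> ?Y \<longleftrightarrow> (\<exists>z. ys = [z] \<and> (z \<noteq> 0 \<longleftrightarrow> n \<in> J))" for ys
    by (auto simp: affine_space_def length_Suc_conv)
  have snoc: "xs @ [z] \<in> stratum (Suc n) J \<longleftrightarrow> xs \<in> stratum n J \<and> (z \<noteq> 0 \<longleftrightarrow> n \<in> J)" for xs z
    by (auto simp: stratum_def affine_space_def nth_append less_Suc_eq)
  have "\<exists>ys z. xs = ys @ [z]" if "xs \<in> stratum (Suc n) J" for xs
    using that by (simp add: stratum_def affine_space_def) (metis length_Suc_conv_rev)
  then show ?thesis
    unfolding set_eq_iff in_product_variety Bex_def Y using snoc by metis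
qed

lemma motivic_class_stratum:
  "quasi_affine (stratum n J) \<and> motivic_class (stratum n J) = (lefschetz - 1) ^ card (J \<inter> {..<n})"
proof (induction n)
  case 0
  have "stratum 0 J = {[]}" by (auto simp: stratum_def affine_space_def)
  then show ?case by (simp add: quasi_affine_point motivic_class_point)
next
  case (Suc n)
  have "J \<inter> {..<Suc n} = (if n \<in> J then insert n (J \<inter> {..<n}) else J \<inter> {..<n})"
    by (auto simp: less_Suc_eq)
  then have "card (J \<inter> {..<Suc n}) = (if n \<in> J then Suc (card (J \<inter> {..<n})) else card (J \<inter> {..<n}))"
    by simp
  moreover have "quasi_affine (if n \<in> J then affine_space 1 - {[0]} else {[0]})"
    by (simp add: motivic_class_origin(1) motivic_class_punctured_line(1) del: One_nat_def)
  ultimately show ?case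
    using Suc by (simp add: stratum_Suc quasi_affine_product_variety motivic_class_product
        motivic_class_origin motivic_class_punctured_line mult.commute del: One_nat_def)
qed

lemma motivic_class_torus: "motivic_class (torus Q) = (lefschetz - 1) ^ card (verts Q)"
proof -
  have "torus Q = stratum (card (verts Q)) UNIV"
    by (auto simp: torus_def stratum_def affine_space_def in_set_conv_nth)
  then show ?thesis using motivic_class_stratum by simp
qed

text \<open>
  Powers of \<open>q - 1\<close> have negative coefficients. To specialise \<open>q\<close> to the class of the affine line in
  them, scalars are extended along the canonical map from the integers.
\<close>

lift_definition int_K0 :: "int \<Rightarrow> K0" is of_int .

lemma int_K0_0: "int_K0 0 = 0" and int_K0_1: "int_K0 1 = 1"
  and int_K0_add: "int_K0 (a + b) = int_K0 a + int_K0 b"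
  and int_K0_diff: "int_K0 (a - b) = int_K0 a - int_K0 b"
  and int_K0_int: "int_K0 (int n) = nat_K0 n"
  by (transfer; simp add: scissor_ideal.zero)+

definition eval_lefschetz :: "int poly \<Rightarrow> K0" where
  "eval_lefschetz p = poly (map_poly int_K0 p) lefschetz"

lemma eval_lefschetz_add: "eval_lefschetz (p + r) = eval_lefschetz p + eval_lefschetz r"
proof -
  have "map_poly int_K0 (p + r) = map_poly int_K0 p + map_poly int_K0 r"
    by (rule poly_eqI) (simp add: coeff_map_poly int_K0_0 int_K0_add)
  then show ?thesis by (simp add: eval_lefschetz_def)
qed

lemma eval_lefschetz_sum: "eval_lefschetz (sum f S) = (\<Sum>x\<in>S. eval_lefschetz (f x))"
  by (induction S rule: infinite_finite_induct) (simp_all add: eval_lefschetz_add, simp_all add: eval_lefschetz_def)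

lemma eval_lefschetz_power: "eval_lefschetz ([:- 1, 1:] ^ n) = (lefschetz - 1) ^ n"
proof (induction n)
  case 0
  show ?case by (simp add: eval_lefschetz_def int_K0_0 int_K0_1 map_poly_pCons one_pCons)
next
  case (Suc n)
  let ?p = "[:- 1, 1 :: int:] ^ n"
  have "[:- 1, 1:] ^ Suc n = pCons 0 ?p - ?p" by simp
  moreover have "map_poly int_K0 (pCons 0 ?p - ?p) = pCons 0 (map_poly int_K0 ?p) - map_poly int_K0 ?p"
    by (rule poly_eqI) (simp add: coeff_map_poly int_K0_0 int_K0_diff coeff_pCons split: nat.split)
  ultimately have "eval_lefschetz ([:- 1, 1:] ^ Suc n) = (lefschetz - 1) * eval_lefschetz ?p"
    by (simp add: eval_lefschetz_def left_diff_distrib)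
  then show ?case using Suc by simp
qed

lemma eval_lefschetz_map_int: "eval_lefschetz (map_poly int P) = poly (map_poly nat_K0 P) lefschetz"
proof -
  have "map_poly int_K0 (map_poly int P) = map_poly nat_K0 P"
  proof (rule poly_eqI)
    fix k
    have "nat_K0 0 = 0" using int_K0_int[of 0] int_K0_0 by simp
    then show "coeff (map_poly int_K0 (map_poly int P)) k = coeff (map_poly nat_K0 P) k"
      by (simp add: coeff_map_poly int_K0_0 int_K0_int)
  qed
  then show ?thesis by (simp add: eval_lefschetz_def)
qed

section \<open>Semistability by weights\<close>

text \<open>
  The imaginary part of \<open>Z(V)\<close> times the degree of a vertex, minus the degree of \<open>V\<close> times the rank of the
  vertex: cross-multiplication turns the comparison of slopes into the sign of this linear function.
\<close>

definition slope_weight ::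
    "('v, 'e) pre_digraph \<Rightarrow> (('v \<Rightarrow>\<^sub>0 int) \<Rightarrow> complex) \<Rightarrow> 'v \<Rightarrow> real" where
  "slope_weight Q Z k =
     - Re (Z (Poly_Mapping.single k 1)) * Im (\<Sum>i\<in>verts Q. Z (Poly_Mapping.single i 1))
     + Re (\<Sum>i\<in>verts Q. Z (Poly_Mapping.single i 1)) * Im (Z (Poly_Mapping.single k 1))"

lemma sum_slope_weight:
  "sum (slope_weight Q Z) I =
     - Re (\<Sum>i\<in>I. Z (Poly_Mapping.single i 1)) * Im (\<Sum>i\<in>verts Q. Z (Poly_Mapping.single i 1))
     + Re (\<Sum>i\<in>verts Q. Z (Poly_Mapping.single i 1)) * Im (\<Sum>i\<in>I. Z (Poly_Mapping.single i 1))"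
  unfolding slope_weight_def
  by (simp only: sum.distrib sum_distrib_left[symmetric]
      sum_distrib_right[symmetric] sum_negf Re_sum Im_sum)

lemma stability_function_sum:
  assumes "stability_function Q Z" "finite I" "I \<subseteq> verts Q"
  shows "Z (\<Sum>i\<in>I. Poly_Mapping.single i 1) = (\<Sum>i\<in>I. Z (Poly_Mapping.single i 1))"
  using assms(2,3)
proof (induction I rule: finite_induct)
  case empty
  have "Z (0 + 0) = Z 0 + Z 0"
    using assms(1) unfolding stability_function_def by (metis empty_subsetI keys_zero)
  then show ?case by simp
next
  case (insert i I)
  have "Poly_Mapping.keys (\<Sum>i\<in>I. Poly_Mapping.single i (1 :: int)) \<subseteq> verts Q"
    using order_trans[OF keys_sum] insert.prems by (force simp: Poly_Mapping.keys_single)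
  moreover have "Poly_Mapping.keys (Poly_Mapping.single i (1 :: int)) \<subseteq> verts Q" using insert.prems by simp
  ultimately have "Z (Poly_Mapping.single i 1 + (\<Sum>i\<in>I. Poly_Mapping.single i 1)) =
      Z (Poly_Mapping.single i 1) + Z (\<Sum>i\<in>I. Poly_Mapping.single i 1)"
    using assms(1) unfolding stability_function_def by blast
  then show ?case using insert by simp
qed

lemma stability_function_half_plane:
  assumes "stability_function Q Z" "i \<in> verts Q"
  shows "Im (Z (Poly_Mapping.single i 1)) > 0 \<or>
    Im (Z (Poly_Mapping.single i 1)) = 0 \<and> Re (Z (Poly_Mapping.single i 1)) < 0"
proof -
  obtain r \<phi> :: real where r: "0 < r" "0 < \<phi>" "\<phi> \<le> 1"
      "Z (Poly_Mapping.single i 1) = complex_of_real r * exp (\<i> * complex_of_real (pi * \<phi>))"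
    using assms unfolding stability_function_def by blast
  have "Z (Poly_Mapping.single i 1) = complex_of_real r * cis (pi * \<phi>)"
    using r(4) by (simp add: cis_conv_exp)
  then have Z: "Re (Z (Poly_Mapping.single i 1)) = r * cos (pi * \<phi>)"
      "Im (Z (Poly_Mapping.single i 1)) = r * sin (pi * \<phi>)"
    by simp_all
  show ?thesis
  proof (cases "\<phi> = 1")
    case True
    then show ?thesis using r(1) by (simp add: Z)
  next
    case False
    then have "sin (pi * \<phi>) > 0" using r by (intro sin_gt_zero) auto
    then show ?thesis using r(1) by (simp add: Z)
  qed
qed

text \<open>
  The values \<open>\<infinity>\<close> of the slope fit in because a set of rank \<open>0\<close> has positive degree: if \<open>V\<close> has rank \<open>0\<close>, the
  weight vanishes and all slopes are \<open>\<infinity>\<close>; otherwise a set of rank \<open>0\<close> has positive weight.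
\<close>

lemma slope_set_le_iff:
  assumes Z: "stability_function Q Z" and fin: "finite (verts Q)" and I: "I \<subseteq> verts Q" "I \<noteq> {}"
  shows "slope_set Z I \<le> slope_set Z (verts Q) \<longleftrightarrow> sum (slope_weight Q Z) I \<le> 0"
proof -
  let ?z = "\<lambda>i. Z (Poly_Mapping.single i 1)"
  let ?V = "verts Q"
  have finI: "finite I" using I fin finite_subset by blast
  note half = stability_function_half_plane[OF Z]
  have Im0: "Im (?z i) \<ge> 0" if "i \<in> ?V" for i using half[OF that] by auto
  have ImI: "Im (sum ?z I) \<ge> 0" unfolding Im_sum by (intro sum_nonneg) (use Im0 I in blast)
  have ImV: "Im (sum ?z ?V) \<ge> Im (sum ?z I)"
    using Im0 I fin by (auto intro: sum_mono2)
  have Re_neg: "Re (sum ?z I) < 0" if "Im (sum ?z I) = 0"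
  proof -
    have "\<forall>i\<in>I. Im (?z i) = 0" using that Im0 I finI by (auto simp: sum_nonneg_eq_0_iff subset_iff)
    then have "\<forall>i\<in>I. Re (?z i) < 0" using half I by fastforce
    then have "(\<Sum>i\<in>I. Re (?z i)) < (\<Sum>i\<in>I. 0)" using finI I(2) by (intro sum_strict_mono) auto
    then show ?thesis by simp
  qed
  have slopes: "slope_set Z I = slope Z (\<Sum>i\<in>I. Poly_Mapping.single i 1)" "Z (\<Sum>i\<in>I. Poly_Mapping.single i 1) = sum ?z I"
      "Z (\<Sum>i\<in>?V. Poly_Mapping.single i 1) = sum ?z ?V"
    using stability_function_sum[OF Z] fin finI I by (auto simp: slope_set_def)
  consider "Im (sum ?z ?V) = 0" | "Im (sum ?z ?V) > 0" "Im (sum ?z I) = 0"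
    | "Im (sum ?z ?V) > 0" "Im (sum ?z I) > 0"
    using ImI ImV by linarith
  then show ?thesis
  proof cases
    case 1
    then show ?thesis using ImI ImV by (simp add: slope_set_def slope_def slopes sum_slope_weight)
  next
    case 2
    then have "Re (sum ?z I) * Im (sum ?z ?V) < 0" using Re_neg by (simp add: mult_neg_pos)
    then show ?thesis using 2
      by (simp only: slope_set_def slope_def slopes sum_slope_weight) simp
  next
    case 3
    have "slope_set Z I \<le> slope_set Z ?V \<longleftrightarrow>
        - Re (sum ?z I) / Im (sum ?z I) \<le> - Re (sum ?z ?V) / Im (sum ?z ?V)"
      using 3 by (simp only: slope_set_def slope_def slopes) simp
    also have "\<dots> \<longleftrightarrow> - Re (sum ?z I) * Im (sum ?z ?V) \<le> - Re (sum ?z ?V) * Im (sum ?z I)"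
    proof -
      have "x / b \<le> y / d \<longleftrightarrow> x * d \<le> y * b" if "b > 0" "d > 0" for x y b d :: real
        using that by (simp add: field_simps)
      then show ?thesis using 3 by blast
    qed
    finally show ?thesis by (simp only: sum_slope_weight) (simp add: algebra_simps)
  qed
qed

lemma slope_weight_total: "sum (slope_weight Q Z) (verts Q) = 0"
  unfolding sum_slope_weight by simp

lemma connected_iff_cut_connected:
  assumes "wf_digraph G"
  shows "Digraph_Component.connected G \<longleftrightarrow> cut_connected (tail G) (head G) (verts G) (arcs G)"
proof -
  interpret wf_digraph G by fact
  let ?R = "rtrancl_on (verts G) (parcs (mk_symmetric G))"
  have edge: "(u, v) \<in> parcs (mk_symmetric G) \<longleftrightarrow>
      (\<exists>b\<in>arcs G. u = tail G b \<and> v = head G b \<or> u = head G b \<and> v = tail G b)" for u v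
    by (auto simp: parcs_mk_symmetric)
  have con: "Digraph_Component.connected G \<longleftrightarrow>
      verts G \<noteq> {} \<and> (\<forall>u\<in>verts G. \<forall>v\<in>verts G. (u, v) \<in> ?R)"
    by (simp add: Digraph_Component.connected_def strongly_connected_def reachable_def)
  show ?thesis
  proof
    assume L: "Digraph_Component.connected G"
    show "cut_connected (tail G) (head G) (verts G) (arcs G)"
    proof (rule cut_connectedI)
      show "verts G \<noteq> {}" using L con by simp
      fix J assume J: "J \<subseteq> verts G" "J \<noteq> {}" "J \<noteq> verts G"
        "\<And>b. b \<in> arcs G \<Longrightarrow> tail G b \<in> J \<longleftrightarrow> head G b \<in> J"
      then obtain u v where uv: "u \<in> J" "v \<in> verts G" "v \<notin> J" by blast
      have "(u, v) \<in> ?R" using L con uv J(1) by blast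
      then have "v \<in> J"
      proof (induction rule: rtrancl_on_induct)
        case (step y z)
        then show ?case using J(4) edge by auto
      qed (use uv in simp)
      then show False using uv by simp
    qed
  next
    assume R: "cut_connected (tail G) (head G) (verts G) (arcs G)"
    have "(u, v) \<in> ?R" if u: "u \<in> verts G" and v: "v \<in> verts G" for u v
    proof -
      let ?J = "{w\<in>verts G. (u, w) \<in> ?R}"
      have "tail G b \<in> ?J \<longleftrightarrow> head G b \<in> ?J" if b: "b \<in> arcs G" for b
      proof -
        have "(tail G b, head G b) \<in> parcs (mk_symmetric G)" "(head G b, tail G b) \<in> parcs (mk_symmetric G)"
          using edge b by blast+
        then show ?thesis using b by (auto intro: rtrancl_on_into_rtrancl_on)
      qed
      then have "?J = {} \<or> ?J = verts G" by (intro cut_connectedD[OF R]) auto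
      moreover have "u \<in> ?J" using u by simp
      ultimately show ?thesis using v by blast
    qed
    moreover have "verts G \<noteq> {}" using R by (simp add: cut_connected_def)
    ultimately show "Digraph_Component.connected G" using con by blast
  qed
qed

text \<open>
  Allowing the empty and the full vertex set makes no difference, since their weight is \<open>0\<close>.
\<close>

lemma semistable_iff_weight_semistable:
  assumes Z: "stability_function Q Z" and fin: "finite (verts Q)"
  shows "weight_semistable (tail Q) (head Q) (verts Q) (slope_weight Q Z) E \<longleftrightarrow>
    (\<forall>I. I \<noteq> {} \<and> I \<subset> verts Q \<and> successor_closed (tail Q) (head Q) E I \<longrightarrow>
      slope_set Z I \<le> slope_set Z (verts Q))"
  unfolding weight_semistable_def
proof (intro iffI allI impI; (elim conjE)?)
  fix I assume "\<forall>J\<subseteq>verts Q. successor_closed (tail Q) (head Q) E J \<longrightarrow> sum (slope_weight Q Z) J \<le> 0"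
    "I \<noteq> {}" "I \<subset> verts Q" "successor_closed (tail Q) (head Q) E I"
  then show "slope_set Z I \<le> slope_set Z (verts Q)"
    using slope_set_le_iff[OF Z fin, of I] by blast
next
  fix J assume J: "\<forall>I. I \<noteq> {} \<and> I \<subset> verts Q \<and> successor_closed (tail Q) (head Q) E I \<longrightarrow>
      slope_set Z I \<le> slope_set Z (verts Q)" "J \<subseteq> verts Q" "successor_closed (tail Q) (head Q) E J"
  consider "J = {}" | "J = verts Q" | "J \<noteq> {}" "J \<subset> verts Q" using J(2) by blast
  then show "sum (slope_weight Q Z) J \<le> 0"
  proof cases
    case 3
    then show ?thesis using J slope_set_le_iff[OF Z fin J(2)] by blast
  qed (simp_all add: slope_weight_total)
qed

lemma abelian_invariant_eq:
  assumes Q: "fin_digraph Q" and Z: "stability_function Q Z"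
  shows "abelian_invariant Q Z =
    weight_invariant (tail Q) (head Q) (verts Q) (arcs Q) (slope_weight Q Z)"
proof -
  interpret fin_digraph Q by fact
  let ?S = "semistable_arc_sets (tail Q) (head Q) (verts Q) (arcs Q) (slope_weight Q Z)"
  have mem: "G \<in> connected_semistable_subquivers Q Z \<longleftrightarrow> arcs G \<in> ?S"
    if G: "spanning G Q" for G
  proof -
    have G': "verts G = verts Q" "tail G = tail Q" "head G = head Q" "arcs G \<subseteq> arcs Q" "wf_digraph G"
      using G by (auto simp: spanning_def subgraph_def compatible_def)
    have "semistable_subquiver Z G \<longleftrightarrow>
        weight_semistable (tail Q) (head Q) (verts Q) (slope_weight Q Z) (arcs G)"
      unfolding semistable_iff_weight_semistable[OF Z finite_verts] semistable_subquiver_def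
        successor_closed_def G'(1-3)
      using wf_digraph.head_in_verts[OF G'(5)] G'(1,3) by auto
    then show ?thesis
      using G connected_iff_cut_connected[OF G'(5)] G'
      by (simp add: connected_semistable_subquivers_def semistable_arc_sets_def)
  qed
  have sub: "spanning (Q\<lparr>arcs := E\<rparr>) Q" if "E \<subseteq> arcs Q" for E
  proof -
    have "wf_digraph (Q\<lparr>arcs := E\<rparr>)" using that by unfold_locales auto
    then show ?thesis
      using that wf_digraph by (simp add: spanning_def subgraph_def compatible_def)
  qed
  show ?thesis
    unfolding abelian_invariant_def weight_invariant_def
  proof (rule sum.reindex_bij_witness[where j = arcs and i = "\<lambda>E. Q\<lparr>arcs := E\<rparr>"])
    fix G assume G: "G \<in> connected_semistable_subquivers Q Z"
    then have sp: "spanning G Q" by (simp add: connected_semistable_subquivers_def)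
    then show "Q\<lparr>arcs := arcs G\<rparr> = G"
      by (auto simp: spanning_def subgraph_def compatible_def intro!: pre_digraph.equality)
    show "arcs G \<in> ?S" using mem[OF sp] G by simp
    show "[:- 1, 1:] ^ (card (arcs G) + 1 - card (verts Q)) = [:- 1, 1:] ^ (card (arcs G) + 1 - card (verts G))"
      using sp by (simp add: spanning_def)
  next
    fix E assume E: "E \<in> ?S"
    show "arcs (Q\<lparr>arcs := E\<rparr>) = E" by simp
    have "E \<subseteq> arcs Q" using E by (simp add: semistable_arc_sets_def)
    from mem[OF sub[OF this]] E show "Q\<lparr>arcs := E\<rparr> \<in> connected_semistable_subquivers Q Z" by simp
  qed
qed

section \<open>Abelian representations and their supports\<close>

definition support :: "('v, 'e) pre_digraph \<Rightarrow> ('e \<Rightarrow> 'k::field) \<Rightarrow> 'e set" where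
  "support Q x = {a\<in>arcs Q. x a \<noteq> 0}"

lemma subspace_of_field:
  fixes S :: "'k::field set"
  assumes "vector_space_over_itself.subspace S"
  shows "S = {0} \<or> S = UNIV"
proof (cases "S = {0}")
  case False
  have "0 \<in> S" using assms by (rule vector_space_over_itself.subspace_0)
  then obtain s where s: "s \<in> S" "s \<noteq> 0" using False by blast
  have "y \<in> S" for y
    using vector_space_over_itself.subspace_scale[OF assms s(1), of "y / s"] s(2) by simp
  then show ?thesis by auto
qed simp

text \<open>
  Since all spaces have dimension one, every subrepresentation is of this form on the vertices.
\<close>

definition coordinate_family :: "'v set \<Rightarrow> 'v \<Rightarrow> 'k::field set" where
  "coordinate_family J i = (if i \<in> J then UNIV else {0})"

lemma UNIV_neq_zero: "(UNIV :: 'k::field set) \<noteq> {0}" "{0} \<noteq> (UNIV :: 'k::field set)"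
  by (metis UNIV_I singletonD one_neq_zero)+

lemma subrepresentation_coordinate_family:
  fixes Q :: "('v, 'e) pre_digraph" and x :: "'e \<Rightarrow> 'k::field"
  shows "subrepresentation Q x (coordinate_family J) \<longleftrightarrow>
    successor_closed (tail Q) (head Q) (support Q x) J"
proof -
  have "vector_space_over_itself.subspace (coordinate_family J i :: 'k set)" for i
    by (simp add: coordinate_family_def vector_space_over_itself.subspace_UNIV
        vector_space_over_itself.subspace_single_0)
  moreover have "(\<forall>u\<in>coordinate_family J (tail Q a). x a * u \<in> coordinate_family J (head Q a)) \<longleftrightarrow>
      (x a \<noteq> 0 \<longrightarrow> tail Q a \<in> J \<longrightarrow> head Q a \<in> J)" for a
    by (auto simp: coordinate_family_def intro: exI[of _ 1])
  ultimately show ?thesis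
    by (auto simp: subrepresentation_def successor_closed_def support_def)
qed

lemma subrepresentation_family:
  assumes "subrepresentation Q x U" "i \<in> verts Q"
  shows "U i = coordinate_family {i\<in>verts Q. U i \<noteq> {0}} i"
  using assms subspace_of_field[of "U i"] by (auto simp: coordinate_family_def subrepresentation_def)

lemma dimension_vector_coordinate_family:
  fixes Q :: "('v, 'e) pre_digraph" and U :: "'v \<Rightarrow> 'k::field set"
  assumes "finite (verts Q)" "J \<subseteq> verts Q" "\<And>i. i \<in> verts Q \<Longrightarrow> U i = coordinate_family J i"
  shows "dimension_vector Q U = (\<Sum>i\<in>J. Poly_Mapping.single i 1)"
proof -
  have "vector_space_over_itself.dim (U i) = (if i \<in> J then 1 else 0)" if "i \<in> verts Q" for i
    using assms(3)[OF that]
    by (simp add: coordinate_family_def dimension_eq_1)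
  then have "dimension_vector Q U =
      (\<Sum>i\<in>verts Q. Poly_Mapping.single i (int (if i \<in> J then 1 else 0)))"
    unfolding dimension_vector_def by (intro sum.cong refl) simp
  also have "\<dots> = (\<Sum>i\<in>J. Poly_Mapping.single i 1)"
    using assms(1,2) by (intro sum.mono_neutral_cong_right) auto
  finally show ?thesis .
qed

lemma semistable_representation_iff:
  fixes Q :: "('v, 'e) pre_digraph" and x :: "'e \<Rightarrow> 'k::field"
  assumes Q: "fin_digraph Q" and Z: "stability_function Q Z"
  shows "semistable_representation Q Z x \<longleftrightarrow>
    weight_semistable (tail Q) (head Q) (verts Q) (slope_weight Q Z) (support Q x)"
proof -
  interpret fin_digraph Q by fact
  let ?closed = "successor_closed (tail Q) (head Q) (support Q x)"
  have V: "dimension_vector Q (\<lambda>_. UNIV :: 'k set) = (\<Sum>i\<in>verts Q. Poly_Mapping.single i 1)"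
    by (rule dimension_vector_coordinate_family) (auto simp: coordinate_family_def)
  have "semistable_representation Q Z x \<longleftrightarrow>
      (\<forall>J. J \<noteq> {} \<and> J \<subset> verts Q \<and> ?closed J \<longrightarrow> slope_set Z J \<le> slope_set Z (verts Q))"
  proof (intro iffI allI impI)
    fix J assume sst: "semistable_representation Q Z x" and J: "J \<noteq> {} \<and> J \<subset> verts Q \<and> ?closed J"
    let ?U = "coordinate_family J :: 'v \<Rightarrow> 'k set"
    have "subrepresentation Q x ?U"
      using J subrepresentation_coordinate_family by blast
    moreover have "nonzero_family Q ?U" "\<exists>i\<in>verts Q. ?U i \<noteq> UNIV"
      using J by (auto simp: nonzero_family_def coordinate_family_def UNIV_neq_zero)
    ultimately have "slope Z (dimension_vector Q ?U) \<le> slope Z (dimension_vector Q (\<lambda>_. UNIV :: 'k set))"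
      using sst unfolding semistable_representation_def by blast
    moreover have "dimension_vector Q ?U = (\<Sum>i\<in>J. Poly_Mapping.single i 1)"
      using J by (intro dimension_vector_coordinate_family) auto
    ultimately show "slope_set Z J \<le> slope_set Z (verts Q)" by (simp add: slope_set_def V)
  next
    assume R: "\<forall>J. J \<noteq> {} \<and> J \<subset> verts Q \<and> ?closed J \<longrightarrow> slope_set Z J \<le> slope_set Z (verts Q)"
    show "semistable_representation Q Z x"
      unfolding semistable_representation_def
    proof (intro allI impI)
      fix U assume U: "subrepresentation Q x U \<and> nonzero_family Q U \<and> (\<exists>i\<in>verts Q. U i \<noteq> UNIV)"
      define J where "J = {i\<in>verts Q. U i \<noteq> {0}}"
      have eq: "U i = coordinate_family J i" if "i \<in> verts Q" for i
        using subrepresentation_family[of Q x U i] U that by (simp add: J_def)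
      have "subrepresentation Q x (coordinate_family J)"
        using U eq unfolding subrepresentation_def by simp
      then have "?closed J" using subrepresentation_coordinate_family by blast
      moreover have "J \<noteq> {}" using U by (auto simp: nonzero_family_def J_def)
      moreover have "J \<noteq> verts Q" using U eq by (auto simp: coordinate_family_def)
      moreover have "J \<subseteq> verts Q" by (auto simp: J_def)
      ultimately have "slope_set Z J \<le> slope_set Z (verts Q)" using R by blast
      moreover have "dimension_vector Q U = (\<Sum>i\<in>J. Poly_Mapping.single i 1)"
        using eq by (intro dimension_vector_coordinate_family) (auto simp: J_def)
      ultimately show "slope Z (dimension_vector Q U) \<le> slope Z (dimension_vector Q (\<lambda>_. UNIV :: 'k set))"
        by (simp add: slope_set_def V)
    qed
  qed
  also have "\<dots> \<longleftrightarrow> weight_semistable (tail Q) (head Q) (verts Q) (slope_weight Q Z) (support Q x)"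
    by (rule semistable_iff_weight_semistable[OF Z finite_verts, symmetric])
  finally show ?thesis .
qed

text \<open>
  The two summands of a decomposition of an abelian representation live on complementary vertex sets,
  both closed under the arrows with non-zero scalar; so no such arrow crosses the cut.
\<close>

lemma indecomposable_representation_iff:
  fixes x :: "'e \<Rightarrow> 'k::field" and Q :: "('v, 'e) pre_digraph"
  assumes "wf_digraph Q"
  shows "indecomposable_representation Q x \<longleftrightarrow>
    cut_connected (tail Q) (head Q) (verts Q) (support Q x)"
proof
  assume L: "indecomposable_representation Q x"
  show "cut_connected (tail Q) (head Q) (verts Q) (support Q x)"
  proof (rule cut_connectedI)
    show "verts Q \<noteq> {}" using L by (simp add: indecomposable_representation_def)
    fix J assume J: "J \<subseteq> verts Q" "J \<noteq> {}" "J \<noteq> verts Q"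
      "\<And>b. b \<in> support Q x \<Longrightarrow> tail Q b \<in> J \<longleftrightarrow> head Q b \<in> J"
    let ?U = "coordinate_family J :: 'v \<Rightarrow> 'k set" and ?W = "coordinate_family (- J) :: 'v \<Rightarrow> 'k set"
    have sub: "subrepresentation Q x ?U" "subrepresentation Q x ?W"
      unfolding subrepresentation_coordinate_family successor_closed_def using J(4) by auto
    have nonzero: "nonzero_family Q ?U" "nonzero_family Q ?W"
      using J(1-3) by (auto simp: nonzero_family_def coordinate_family_def UNIV_neq_zero)
    have sum: "?U i \<inter> ?W i = {0} \<and> {u + w | u w. u \<in> ?U i \<and> w \<in> ?W i} = UNIV" for i
      by (cases "i \<in> J") (simp_all add: coordinate_family_def)
    show False
      by (rule notE[OF conjunct2[OF L[unfolded indecomposable_representation_def]]],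
          intro exI[of _ ?U] exI[of _ ?W] conjI ballI; (rule sub nonzero sum[THEN conjunct1] sum[THEN conjunct2]))
  qed
next
  assume R: "cut_connected (tail Q) (head Q) (verts Q) (support Q x)"
  have no: False if UW: "subrepresentation Q x U" "subrepresentation Q x W"
    "nonzero_family Q U" "nonzero_family Q W"
    "\<And>i. i \<in> verts Q \<Longrightarrow> U i \<inter> W i = {0} \<and> {u + w | u w. u \<in> U i \<and> w \<in> W i} = UNIV"
  for U W :: "'v \<Rightarrow> 'k set"
  proof -
    define J where "J = {i\<in>verts Q. U i \<noteq> {0}}"
    have U: "U i = coordinate_family J i" if "i \<in> verts Q" for i
      using subrepresentation_family[OF UW(1) that] by (simp add: J_def)
    have W: "W i = coordinate_family (- J) i" if i: "i \<in> verts Q" for i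
    proof -
      have "W i = {0} \<or> W i = UNIV"
        using UW(2) i subspace_of_field[of "W i"] by (simp add: subrepresentation_def)
      moreover have "W i \<noteq> UNIV" if "U i = UNIV"
        using UW(5)[OF i] that UNIV_neq_zero by auto
      moreover have "W i \<noteq> {0}" if "U i = {0}"
        using UW(5)[OF i] that UNIV_neq_zero by auto
      ultimately show ?thesis using U[OF i] by (cases "i \<in> J") (simp_all add: coordinate_family_def)
    qed
    have "subrepresentation Q x (coordinate_family J)" "subrepresentation Q x (coordinate_family (- J))"
      using UW(1,2) U W wf_digraph.head_in_verts[OF assms] wf_digraph.tail_in_verts[OF assms]
      unfolding subrepresentation_def by simp_all
    then have "successor_closed (tail Q) (head Q) (support Q x) J"
      "successor_closed (tail Q) (head Q) (support Q x) (- J)"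
      using subrepresentation_coordinate_family by blast+
    then have nc: "tail Q b \<in> J \<longleftrightarrow> head Q b \<in> J" if "b \<in> support Q x" for b
      using that by (auto simp: successor_closed_def)
    have J: "J = {} \<or> J = verts Q"
    proof (rule cut_connectedD[OF R])
      show "J \<subseteq> verts Q" by (auto simp: J_def)
    qed (rule nc)
    obtain i where i: "i \<in> J" using UW(3) by (auto simp: nonzero_family_def J_def)
    obtain j where j: "j \<in> verts Q" "W j \<noteq> {0}" using UW(4) by (auto simp: nonzero_family_def)
    have "j \<notin> J" using W[OF j(1)] j(2) by (simp add: coordinate_family_def split: if_splits)
    then show False using J i j(1) by auto
  qed
  show "indecomposable_representation Q x"
    unfolding indecomposable_representation_def
  proof (intro conjI notI)
    show "verts Q = {} \<Longrightarrow> False" using R by (simp add: cut_connected_def)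
    assume "\<exists>U W :: 'v \<Rightarrow> 'k set. subrepresentation Q x U \<and> subrepresentation Q x W \<and>
      nonzero_family Q U \<and> nonzero_family Q W \<and>
      (\<forall>i\<in>verts Q. U i \<inter> W i = {0} \<and> {u + w | u w. u \<in> U i \<and> w \<in> W i} = UNIV)"
    then obtain U W :: "'v \<Rightarrow> 'k set" where "subrepresentation Q x U" "subrepresentation Q x W"
      "nonzero_family Q U" "nonzero_family Q W"
      and sum: "\<forall>i\<in>verts Q. U i \<inter> W i = {0} \<and> {u + w | u w. u \<in> U i \<and> w \<in> W i} = UNIV"
      by (elim exE conjE)
    then show False by (intro no[of U W] bspec[OF sum])
  qed
qed

text \<open>
  Whether a representation is indecomposable and semistable depends only on its support, so every
  coordinate stratum lies in the locus or is disjoint from it.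
\<close>

lemma motivic_class_R_ind:
  assumes Q: "fin_digraph Q" and Z: "stability_function Q Z"
  shows "motivic_class (R_ind Q Z) =
    (\<Sum>G\<in>semistable_arc_sets (tail Q) (head Q) (verts Q) (arcs Q) (slope_weight Q Z).
      (lefschetz - 1) ^ card G)"
proof -
  interpret fin_digraph Q by fact
  let ?es = "arc_list Q" and ?n = "length (arc_list Q)"
  let ?S = "semistable_arc_sets (tail Q) (head Q) (verts Q) (arcs Q) (slope_weight Q Z)"
  let ?g = "\<lambda>J. (!) ?es ` J"
  have es: "distinct ?es" "set ?es = arcs Q"
    using someI_ex[of "\<lambda>es. distinct es \<and> set es = arcs Q"] finite_distinct_list[OF finite_arcs]
    unfolding arc_list_def by auto
  have inj: "inj_on ((!) ?es) {..<?n}" using es(1) by (auto simp: inj_on_def nth_eq_iff_index_eq)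
  have range: "(!) ?es ` {..<?n} = arcs Q" using es(2) by (auto simp: set_conv_nth)
  have good: "indecomposable_representation Q x \<and> semistable_representation Q Z x \<longleftrightarrow> support Q x \<in> ?S"
    for x :: "'b \<Rightarrow> complex"
    using indecomposable_representation_iff[OF wf_digraph, of x] semistable_representation_iff[OF Q Z, of x]
    by (auto simp: semistable_arc_sets_def support_def)
  have qa: "quasi_affine_in ?n (R_ind Q Z)"
    using quasi_affine_R_ind[OF Q] by (rule quasi_affine_imp_in) (auto simp: R_ind_def affine_space_def)
  have strata: "{xs \<in> R_ind Q Z. \<forall>j<?n. xs ! j \<noteq> 0 \<longleftrightarrow> j \<in> J} = (if ?g J \<in> ?S then stratum ?n J else {})"
    if J: "J \<in> Pow {..<?n}" for J
  proof -
    have supp: "support Q x = ?g J"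
      if x: "\<forall>j<?n. map x ?es ! j \<noteq> 0 \<longleftrightarrow> j \<in> J" for x :: "'b \<Rightarrow> complex"
      unfolding support_def range[symmetric] using x J by auto
    have "xs \<in> R_ind Q Z \<longleftrightarrow> ?g J \<in> ?S" if xs: "xs \<in> stratum ?n J" for xs
    proof -
      define y where "y a = the (map_of (zip ?es xs) a)" for a
      have len: "length xs = ?n" using xs by (simp add: stratum_def affine_space_def)
      have "y (?es ! j) = xs ! j" if "j < ?n" for j
        using that len es(1) by (simp add: y_def map_of_zip_nth)
      then have y: "map y ?es = xs" using len by (intro nth_equalityI) auto
      have nz: "\<forall>j<?n. xs ! j \<noteq> 0 \<longleftrightarrow> j \<in> J" using xs by (simp add: stratum_def)
      have "support Q x = ?g J" if "map x ?es = xs" for x using supp nz that by blast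
      moreover have "xs \<in> R_ind Q Z \<longleftrightarrow> (\<exists>x. map x ?es = xs \<and> support Q x \<in> ?S)"
        by (auto simp: R_ind_def good)
      ultimately show ?thesis using y by metis
    qed
    moreover have "{xs \<in> R_ind Q Z. \<forall>j<?n. xs ! j \<noteq> 0 \<longleftrightarrow> j \<in> J} = {xs \<in> stratum ?n J. xs \<in> R_ind Q Z}"
      by (auto simp: stratum_def affine_space_def R_ind_def)
    ultimately show ?thesis by auto
  qed
  have "motivic_class (R_ind Q Z) =
      (\<Sum>J\<in>Pow {..<?n}. if ?g J \<in> ?S then (lefschetz - 1) ^ card (?g J) else 0)"
    unfolding motivic_class_strata[OF qa order_refl]
  proof (rule sum.cong)
    fix J assume J: "J \<in> Pow {..<?n}"
    then have "card (?g J) = card (J \<inter> {..<?n})"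
      using inj_on_subset[OF inj, of J] by (simp add: card_image Int_absorb2)
    then show "motivic_class {xs \<in> R_ind Q Z. \<forall>j<?n. xs ! j \<noteq> 0 \<longleftrightarrow> j \<in> J} =
        (if ?g J \<in> ?S then (lefschetz - 1) ^ card (?g J) else 0)"
      unfolding strata[OF J] using motivic_class_stratum motivic_class_empty by simp
  qed simp
  also have "\<dots> = (\<Sum>G\<in>(\<lambda>J. ?g J) ` Pow {..<?n}. if G \<in> ?S then (lefschetz - 1) ^ card G else 0)"
    by (subst sum.reindex[OF inj_on_image_Pow[OF inj]]) (simp add: o_def)
  also have "(\<lambda>J. ?g J) ` Pow {..<?n} = Pow (arcs Q)"
    using image_Pow_surj[OF range] by simp
  also have "(\<Sum>G\<in>Pow (arcs Q). if G \<in> ?S then (lefschetz - 1) ^ card G else 0) =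
      (\<Sum>G\<in>?S. (lefschetz - 1) ^ card G)"
    by (intro sum.mono_neutral_cong_right) (auto simp: semistable_arc_sets_def)
  finally show ?thesis .
qed

lemma nonneg_coeffs_imp_nat_poly:
  assumes "nonneg_coeffs p"
  shows "\<exists>P :: nat poly. p = map_poly int P"
proof
  show "p = map_poly int (map_poly nat p)"
    using assms by (intro poly_eqI) (simp add: coeff_map_poly nonneg_coeffs_def)
qed

theorem theorem7p15:
  fixes Q :: "('v, 'e) pre_digraph"
    and Z :: "('v \<Rightarrow>\<^sub>0 int) \<Rightarrow> complex"
  assumes "fin_digraph Q"
    and "stability_function Q Z"
  shows "\<exists>P :: nat poly.
    abelian_invariant Q Z = map_poly int P \<and>
    (lefschetz - 1) * motivic_class (R_ind Q Z) =
      poly (map_poly nat_K0 P) lefschetz * motivic_class (torus Q)"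
proof -
  interpret fin_digraph Q by fact
  let ?S = "semistable_arc_sets (tail Q) (head Q) (verts Q) (arcs Q) (slope_weight Q Z)"
  let ?V = "verts Q"
  have "nonneg_coeffs (abelian_invariant Q Z)"
    unfolding abelian_invariant_eq[OF assms]
    by (rule weight_invariant_nonneg) (simp_all add: slope_weight_total)
  then obtain P :: "nat poly" where P: "abelian_invariant Q Z = map_poly int P"
    using nonneg_coeffs_imp_nat_poly by blast
  have "poly (map_poly nat_K0 P) lefschetz * motivic_class (torus Q) =
      (\<Sum>G\<in>?S. (lefschetz - 1) ^ (card G + 1 - card ?V)) * (lefschetz - 1) ^ card ?V"
    unfolding eval_lefschetz_map_int[symmetric] P[symmetric] abelian_invariant_eq[OF assms]
      weight_invariant_def eval_lefschetz_sum eval_lefschetz_power motivic_class_torus ..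
  also have "\<dots> = (\<Sum>G\<in>?S. (lefschetz - 1) * (lefschetz - 1) ^ card G)"
    unfolding sum_distrib_right
  proof (rule sum.cong)
    fix G assume G: "G \<in> ?S"
    have "card ?V \<le> card G + 1"
      by (rule semistable_arc_sets_card(2)[OF finite_verts finite_arcs _ G]) simp
    then have "(card G + 1 - card ?V) + card ?V = Suc (card G)" by simp
    then show "(lefschetz - 1) ^ (card G + 1 - card ?V) * (lefschetz - 1) ^ card ?V =
        (lefschetz - 1) * (lefschetz - 1) ^ card G"
      by (simp only: power_add[symmetric] power_Suc[symmetric])
  qed simp
  also have "\<dots> = (lefschetz - 1) * motivic_class (R_ind Q Z)"
    by (simp only: motivic_class_R_ind[OF assms] sum_distrib_left)
  finally show ?thesis using P by metis
qed

end
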